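(* Let $n, d \geq 2$ be integers. Then $\operatorname{Ork}(2,d) = d$ and $\operatorname{Ork}(n,2) = n$. Moreover, \[ \operatorname{Ork}(n,d) \leq \operatorname{Ork}(n-1,d) + \operatorname{Ork}(n,d-1) \] for all integers $n, d \geq 3$.
   Context: Let $k$ be an algebraically closed field of characteristic $0$. For $n \ge 1$ let $S = k[x_1,\dots,x_n]$ and let $S_d$ be the space of homogeneous polynomials (forms) of degree $d$ in $S$. The space $S_1$ of linear forms is regarded as the affine space $\mathbb{A}^n$ over $k$ with its Zariski topology. A closed subset $V\subsetneq S_1$ is called homogeneous if it is the zero set of a set of homogeneous polynomials, i.e. it is stable under multiplication by scalars (the empty set is allowed). A form $F \in S_d$ essentially depends on $n$ variables if it cannot be written using fewer than $n$ variables after a linear change of coordinates. For $F \in S_d$ and $V \subseteq S_1$, let $\operatorname{Ork}(F,V)$ be the minimal natural number $m$ such that there is a presentation $F = \sum_{i=1}^m l_i^d$ with all $l_i \in S_1 \setminus V$, and $\operatorname{Ork}(F,V) = \infty$ if no such presentation exists. The open Waring rank of $F$ is \[ \operatorname{Ork}(F) = \sup\{\operatorname{Ork}(F,V) \mid V \subsetneq S_1 \text{ homogeneous and Zariski closed}\}, \] and \[ \operatorname{Ork}(n,d) = \sup\{\operatorname{Ork}(F) \mid F \in S_d \text{ essentially depends on } n \text{ variables}\}, \] where $S = k[x_1,\dots,x_n]$. *)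

theory Defs
  imports
    "HOL-Library.Poly_Mapping"
    "HOL-Library.Extended_Nat"
    "HOL-Computational_Algebra.Polynomial"
    "Jordan_Normal_Form.Matrix"
begin

text \<open>
  Polynomials in the variables \<open>x\<^sub>0, x\<^sub>1, \<dots>\<close> are finitely supported maps from monomials to
  coefficients, where a monomial is the finitely supported map from variable indices to exponents.
  The ring \<open>k[x\<^sub>1,\<dots>,x\<^sub>n]\<close> is rendered as the set of polynomials using only the indices below \<open>n\<close>.
\<close>

type_synonym 'k mpoly = "(nat \<Rightarrow>\<^sub>0 nat) \<Rightarrow>\<^sub>0 'k"

definition mvar :: "nat \<Rightarrow> 'k::field mpoly" where
  "mvar i = Poly_Mapping.single (Poly_Mapping.single i 1) 1"

definition mconst :: "'k::field \<Rightarrow> 'k mpoly" where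
  "mconst c = Poly_Mapping.single 0 c"

definition mvars :: "'k::field mpoly \<Rightarrow> nat set" where
  "mvars p = (\<Union>m\<in>Poly_Mapping.keys p. Poly_Mapping.keys m)"

definition mon_degree :: "(nat \<Rightarrow>\<^sub>0 nat) \<Rightarrow> nat" where
  "mon_degree m = (\<Sum>i\<in>Poly_Mapping.keys m. Poly_Mapping.lookup m i)"

text \<open>The space \<open>S\<^sub>d\<close> for \<open>S = k[x\<^sub>1,\<dots>,x\<^sub>n]\<close>; it contains the zero polynomial for every \<open>d\<close>.\<close>

definition forms :: "nat \<Rightarrow> nat \<Rightarrow> 'k::field mpoly set" where
  "forms n d = {p. mvars p \<subseteq> {..<n} \<and> (\<forall>m\<in>Poly_Mapping.keys p. mon_degree m = d)}"

text \<open>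
  The value of \<open>p\<close> under \<open>x\<^sub>i \<mapsto> g i\<close>, with coefficients sent to the target ring by \<open>c\<close>.
\<close>

definition aeval :: "('k::field \<Rightarrow> 'b::comm_semiring_1) \<Rightarrow> (nat \<Rightarrow> 'b) \<Rightarrow> 'k mpoly \<Rightarrow> 'b" where
  "aeval c g p = (\<Sum>m\<in>Poly_Mapping.keys p.
     c (Poly_Mapping.lookup p m) *
       (\<Prod>i\<in>Poly_Mapping.keys m. g i ^ Poly_Mapping.lookup m i))"

definition meval :: "(nat \<Rightarrow> 'k) \<Rightarrow> 'k::field mpoly \<Rightarrow> 'k" where
  "meval = aeval (\<lambda>c. c)"

definition msubst :: "(nat \<Rightarrow> 'k mpoly) \<Rightarrow> 'k::field mpoly \<Rightarrow> 'k mpoly" where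
  "msubst = aeval mconst"

definition lin_change :: "nat \<Rightarrow> 'k::field mat \<Rightarrow> 'k mpoly \<Rightarrow> 'k mpoly" where
  "lin_change n A = msubst (\<lambda>i. \<Sum>j<n. mconst (A $$ (i, j)) * mvar j)"

definition essentially_depends :: "nat \<Rightarrow> 'k::field mpoly \<Rightarrow> bool" where
  "essentially_depends n F \<longleftrightarrow>
     \<not> (\<exists>A\<in>carrier_mat n n. invertible_mat A \<and> card (mvars (lin_change n A F)) < n)"

text \<open>The point of affine \<open>n\<close>-space corresponding to a linear form.\<close>

definition lin_coords :: "'k::field mpoly \<Rightarrow> nat \<Rightarrow> 'k" where
  "lin_coords l i = Poly_Mapping.lookup l (Poly_Mapping.single i 1)"

text \<open>
  Zero sets in \<open>S\<^sub>1\<close> of families of homogeneous polynomials, possibly of different degrees.  Nonzero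
  constants are forms of degree \<open>0\<close>, so the empty set is included.
\<close>

definition homogeneous_closed :: "nat \<Rightarrow> 'k::field mpoly set \<Rightarrow> bool" where
  "homogeneous_closed n V \<longleftrightarrow>
     (\<exists>P \<subseteq> (\<Union>e. forms n e). V = {l \<in> forms n 1. \<forall>p\<in>P. meval (lin_coords l) p = 0})"

text \<open>The infimum of the empty set in \<^typ>\<open>enat\<close> is \<open>\<infinity>\<close>.\<close>

definition Ork_avoiding :: "nat \<Rightarrow> nat \<Rightarrow> 'k::field mpoly \<Rightarrow> 'k mpoly set \<Rightarrow> enat" where
  "Ork_avoiding n d F V =
     Inf {enat m |m. \<exists>l. (\<forall>i<m. l i \<in> forms n 1 - V) \<and> F = (\<Sum>i<m. l i ^ d)}"

definition Ork_form :: "nat \<Rightarrow> nat \<Rightarrow> 'k::field mpoly \<Rightarrow> enat" where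
  "Ork_form n d F = Sup {Ork_avoiding n d F V |V. V \<subset> forms n 1 \<and> homogeneous_closed n V}"

definition Ork :: "'k::field itself \<Rightarrow> nat \<Rightarrow> nat \<Rightarrow> enat" where
  "Ork _ n d = Sup {Ork_form n d F |F :: 'k mpoly. F \<in> forms n d \<and> essentially_depends n F}"

end

theory Submission
  imports Defs "Jordan_Normal_Form.Determinant"
begin

text \<open>
  The upper bounds rest on integrating a decomposition of a directional derivative. If
  \<open>\<partial>\<^sub>p F = \<Sum>\<^sub>i l\<^sub>i\<^bsup>d-1\<^esup>\<close> with \<open>l\<^sub>i(p) \<noteq> 0\<close>, then the sum of suitable multiples of the \<open>l\<^sub>i\<^sup>d\<close> has the same
  derivative as \<open>F\<close>. The difference \<open>R\<close> is killed by \<open>\<partial>\<^sub>p\<close>, and in characteristic \<open>0\<close> it is a form in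
  the \<open>n - 1\<close> linear forms that vanish at \<open>p\<close> (\<open>dderiv_eq_0_imp_fewer_variables\<close>). A decomposition of
  \<open>R\<close> thus completes one of \<open>F\<close>. The forbidden closed set may be taken to be a hypersurface \<open>f = 0\<close>
  (\<open>Ork_le_iff\<close>).

  The difficulty is that \<open>Ork n d\<close> only controls forms that essentially depend on all \<open>n\<close> variables,
  whereas \<open>R\<close> may degenerate and \<open>\<partial>\<^sub>p F\<close> may even do so for every \<open>p\<close>, as happens for cubics with
  vanishing Hessian. A degenerate form becomes nondegenerate when powers of the missing variables are
  added; a decomposition of the sum is then mapped back by a substitution that may send the missing
  variables anywhere, provided that its image is not contained in \<open>f = 0\<close>
  (\<open>ork_le_msubst_add_powers\<close>). Sending them to \<open>0\<close> works unless the remaining variables span a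
  subspace of \<open>f = 0\<close>. Two spare variables can be sent to \<open>l\<close> and \<open>\<zeta> l\<close> with \<open>\<zeta>\<^sup>d = -1\<close>, so that
  their powers cancel. One spare variable can be used to absorb a power \<open>l\<^sup>d\<close> that is present anyway,
  and this settles the case of a degenerate \<open>R\<close>. For \<open>\<partial>\<^sub>p F\<close> there remains the case that it lives
  exactly on a hyperplane contained in \<open>f = 0\<close>. There are only finitely many such hyperplanes
  (\<open>finite_hyperplanes_in_hypersurface\<close>), and a generic \<open>p\<close> avoids all of them. This proves the
  recursion (\<open>ork_le_recursion\<close>), for \<open>n = 2\<close> as well.

  For quadratic forms the derivative is a single linear form, so each variable costs one power.
  Together with the trivial bound \<open>1\<close> for one variable this gives \<open>n\<close> for quadratic forms, and then
  the recursion gives \<open>d\<close> for binary forms. These bounds are attained by \<open>\<Sum>\<^sub>i x\<^sub>i\<^sup>2\<close> and by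
  \<open>x y\<^bsup>d-1\<^esup>\<close>.
\<close>

section \<open>Evaluation of polynomials\<close>

lemma mpoly_eq_sum_single:
  "p = (\<Sum>m\<in>Poly_Mapping.keys p. Poly_Mapping.single m (Poly_Mapping.lookup p m))"
proof (rule poly_mapping_eqI)
  fix k
  show "Poly_Mapping.lookup p k = Poly_Mapping.lookup
     (\<Sum>m\<in>Poly_Mapping.keys p. Poly_Mapping.single m (Poly_Mapping.lookup p m)) k"
    by (simp add: lookup_sum lookup_single when_def in_keys_iff)
qed

text \<open>
  Monomials are generated from \<open>1\<close> by multiplying with variables; this yields the
  two induction principles for polynomials and for forms.
\<close>

lemma single_add_induct [case_names zero add]:
  fixes m :: "nat \<Rightarrow>\<^sub>0 nat"
  assumes "P 0" and "\<And>i m. P m \<Longrightarrow> P (Poly_Mapping.single i 1 + m)"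
  shows "P m"
proof (induction "mon_degree m" arbitrary: m)
  case 0
  have "m = 0"
  proof (rule poly_mapping_eqI)
    fix i
    show "Poly_Mapping.lookup m i = Poly_Mapping.lookup 0 i"
      using 0 by (cases "i \<in> Poly_Mapping.keys m") (auto simp: mon_degree_def in_keys_iff)
  qed
  with assms(1) show ?case by simp
next
  case (Suc d)
  then obtain i where i: "i \<in> Poly_Mapping.keys m"
    by (metis mon_degree_def sum.empty ex_in_conv nat.distinct(1))
  define m' where "m' = m - Poly_Mapping.single i 1"
  have m: "m = Poly_Mapping.single i 1 + m'"
    using i by (intro poly_mapping_eqI)
      (auto simp: m'_def lookup_add lookup_minus lookup_single when_def in_keys_iff)
  have lk: "Poly_Mapping.lookup m j = (if i = j then 1 else 0) + Poly_Mapping.lookup m' j" for j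
    by (subst m) (simp add: lookup_add lookup_single when_def)
  have "mon_degree m = (\<Sum>j\<in>Poly_Mapping.keys m. (if i = j then 1 else 0) + Poly_Mapping.lookup m' j)"
    unfolding mon_degree_def by (intro sum.cong refl lk)
  also have "\<dots> = 1 + (\<Sum>j\<in>Poly_Mapping.keys m. Poly_Mapping.lookup m' j)"
    using i by (simp add: sum.distrib)
  also have "(\<Sum>j\<in>Poly_Mapping.keys m. Poly_Mapping.lookup m' j) = mon_degree m'"
    unfolding mon_degree_def
    by (rule sum.mono_neutral_right) (auto simp: in_keys_iff lk)
  finally have "d = mon_degree m'" using Suc(2) by simp
  from assms(2)[OF Suc(1)[OF this]] show ?case by (subst m)
qed

lemma mult_mvar_single:
  "mvar i * Poly_Mapping.single m a = Poly_Mapping.single (Poly_Mapping.single i 1 + m) a"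
  by (simp add: mvar_def mult_single)

lemma mpoly_induct [case_names const add var_mult]:
  fixes F :: "'k::field mpoly"
  assumes "\<And>c. P (mconst c)" and "\<And>F G. P F \<Longrightarrow> P G \<Longrightarrow> P (F + G)"
    and "\<And>i F. P F \<Longrightarrow> P (mvar i * F)"
  shows "P F"
proof -
  have single: "P (Poly_Mapping.single m a)" for m a
  proof (induction m rule: single_add_induct)
    case zero
    then show ?case using assms(1)[of a] by (simp add: mconst_def)
  next
    case (add i m)
    then show ?case using assms(3)[of _ i] by (metis mult_mvar_single)
  qed
  have "P (\<Sum>m\<in>A. Poly_Mapping.single m (Poly_Mapping.lookup F m))" if "finite A" for A
    using that
  proof induction
    case empty
    then show ?case using assms(1)[of 0] by (simp add: mconst_def)
  qed (simp add: assms(2) single)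
  then show ?thesis by (subst mpoly_eq_sum_single) simp
qed

definition mon_eval :: "(nat \<Rightarrow> 'b::comm_semiring_1) \<Rightarrow> (nat \<Rightarrow>\<^sub>0 nat) \<Rightarrow> 'b" where
  "mon_eval g m = (\<Prod>i\<in>Poly_Mapping.keys m. g i ^ Poly_Mapping.lookup m i)"

lemma mon_eval_superset:
  assumes "finite A" "Poly_Mapping.keys m \<subseteq> A"
  shows "mon_eval g m = (\<Prod>i\<in>A. g i ^ Poly_Mapping.lookup m i)"
  unfolding mon_eval_def
  by (rule prod.mono_neutral_left) (use assms in \<open>auto simp: in_keys_iff\<close>)

lemma mon_eval_add: "mon_eval g (m + m') = mon_eval g m * mon_eval g m'"
proof -
  let ?A = "Poly_Mapping.keys m \<union> Poly_Mapping.keys m'"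
  have "Poly_Mapping.keys (m + m') \<subseteq> ?A" by (rule keys_add)
  then show ?thesis
    by (simp add: mon_eval_superset[of ?A] lookup_add power_add prod.distrib)
qed

lemma mon_eval_0 [simp]: "mon_eval g 0 = 1"
  by (simp add: mon_eval_def)

lemma aeval_superset:
  assumes "comm_ring_hom c" "finite A" "Poly_Mapping.keys p \<subseteq> A"
  shows "aeval c g p = (\<Sum>m\<in>A. c (Poly_Mapping.lookup p m) * mon_eval g m)"
  unfolding aeval_def mon_eval_def[symmetric]
proof (rule sum.mono_neutral_left)
  interpret c: comm_ring_hom c by fact
  show "\<forall>i\<in>A - Poly_Mapping.keys p. c (Poly_Mapping.lookup p i) * mon_eval g i = 0"
    by (auto simp: in_keys_iff)
qed (use assms in auto)

lemma aeval_add: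
  assumes "comm_ring_hom c"
  shows "aeval c g (p + q) = aeval c g p + aeval c g q"
proof -
  interpret c: comm_ring_hom c by fact
  let ?A = "Poly_Mapping.keys p \<union> Poly_Mapping.keys q"
  have "Poly_Mapping.keys (p + q) \<subseteq> ?A" by (rule keys_add)
  then show ?thesis
    by (simp add: aeval_superset[OF assms, of ?A] lookup_add c.hom_add distrib_right sum.distrib)
qed

lemma aeval_single:
  assumes "comm_ring_hom c"
  shows "aeval c g (Poly_Mapping.single m a) = c a * mon_eval g m"
proof -
  have "Poly_Mapping.keys (Poly_Mapping.single m a) \<subseteq> {m}" by simp
  then show ?thesis
    by (simp add: aeval_superset[OF assms, of "{m}"])
qed

lemma aeval_mconst [simp]: "comm_ring_hom c \<Longrightarrow> aeval c g (mconst a) = c a"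
  by (simp add: mconst_def aeval_single)

lemma aeval_mvar [simp]: "comm_ring_hom c \<Longrightarrow> aeval c g (mvar i) = g i"
proof -
  assume c: "comm_ring_hom c"
  then interpret c: comm_ring_hom c .
  show ?thesis by (simp add: mvar_def aeval_single[OF c] mon_eval_def)
qed

lemma aeval_sum:
  assumes "comm_ring_hom c"
  shows "aeval c g (\<Sum>x\<in>A. f x) = (\<Sum>x\<in>A. aeval c g (f x))"
proof (induction A rule: infinite_finite_induct)
  case empty
  then show ?case by (simp add: aeval_def)
next
  case (infinite A)
  then show ?case by (simp add: aeval_def)
qed (simp add: aeval_add[OF assms])

lemma aeval_mult:
  assumes "comm_ring_hom c"
  shows "aeval c g (p * q) = aeval c g p * aeval c g q"
proof -
  interpret c: comm_ring_hom c by fact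
  let ?l = Poly_Mapping.lookup
  have "p * q = (\<Sum>m\<in>Poly_Mapping.keys p. \<Sum>m'\<in>Poly_Mapping.keys q.
      Poly_Mapping.single (m + m') (?l p m * ?l q m'))"
    by (subst mpoly_eq_sum_single[of p], subst mpoly_eq_sum_single[of q])
      (simp add: sum_product mult_single)
  then have "aeval c g (p * q) = (\<Sum>m\<in>Poly_Mapping.keys p. \<Sum>m'\<in>Poly_Mapping.keys q.
      (c (?l p m) * mon_eval g m) * (c (?l q m') * mon_eval g m'))"
    by (simp add: aeval_sum[OF assms] aeval_single[OF assms] c.hom_mult mon_eval_add ac_simps)
  also have "\<dots> = aeval c g p * aeval c g q"
    by (simp add: sum_product aeval_def mon_eval_def)
  finally show ?thesis .
qed

lemma comm_ring_hom_aeval: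
  assumes "comm_ring_hom c"
  shows "comm_ring_hom (aeval c g)"
proof -
  interpret c: comm_ring_hom c by fact
  have one: "aeval c g 1 = 1"
    using aeval_mconst[OF assms, of g 1] by (simp add: mconst_def)
  have zero: "aeval c g 0 = 0"
    by (simp add: aeval_def)
  show ?thesis
    by unfold_locales (simp_all add: aeval_add[OF assms] aeval_mult[OF assms] one zero)
qed

lemma aeval_cong:
  assumes "\<And>i. i \<in> mvars p \<Longrightarrow> g i = g' i"
  shows "aeval c g p = aeval c g' p"
proof -
  have "g i = g' i" if "m \<in> Poly_Mapping.keys p" "i \<in> Poly_Mapping.keys m" for m i
    using that by (intro assms) (auto simp: mvars_def)
  then show ?thesis
    unfolding aeval_def by (simp cong: sum.cong prod.cong)
qed

text \<open>
  A ring homomorphism out of the polynomial ring is determined by its values on constants and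
  variables; all compositions of substitutions below are computed in this way.
\<close>

lemma hom_aeval:
  assumes "comm_ring_hom h"
  shows "h (aeval c g p) = aeval (\<lambda>a. h (c a)) (\<lambda>i. h (g i)) p"
proof -
  interpret h: comm_ring_hom h by fact
  show ?thesis
    by (simp add: aeval_def h.hom_sum h.hom_mult h.hom_prod h.hom_power)
qed

lemma comm_ring_hom_id: "comm_ring_hom (\<lambda>c::'k::comm_ring_1. c)"
  by unfold_locales auto

lemma comm_ring_hom_mconst: "comm_ring_hom mconst"
  by unfold_locales (simp_all add: mconst_def single_add mult_single flip: single_one)

lemma comm_ring_hom_poly_const: "comm_ring_hom (\<lambda>c. [:c::'a::comm_ring_1:])"
  by unfold_locales simp_all

lemma comm_ring_hom_poly_mconst: "comm_ring_hom (\<lambda>c. [:mconst c:])"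
proof -
  interpret mconst: comm_ring_hom mconst by (rule comm_ring_hom_mconst)
  show ?thesis
    by unfold_locales (simp_all add: mconst.hom_add mconst.hom_mult)
qed

interpretation mconst: comm_ring_hom mconst
  by (rule comm_ring_hom_mconst)

interpretation msubst: comm_ring_hom "msubst w"
  unfolding msubst_def by (intro comm_ring_hom_aeval comm_ring_hom_mconst)

interpretation meval: comm_ring_hom "meval a"
  unfolding meval_def by (intro comm_ring_hom_aeval comm_ring_hom_id)

lemma msubst_mconst [simp]: "msubst w (mconst a) = mconst a"
  by (simp add: msubst_def comm_ring_hom_mconst)

lemma msubst_mvar [simp]: "msubst w (mvar i) = w i"
  by (simp add: msubst_def comm_ring_hom_mconst)

lemma meval_mconst [simp]: "meval g (mconst a) = a"
  by (simp add: meval_def comm_ring_hom_id)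

lemma meval_mvar [simp]: "meval g (mvar i) = g i"
  by (simp add: meval_def comm_ring_hom_id)

lemma msubst_msubst: "msubst w (msubst v p) = msubst (\<lambda>i. msubst w (v i)) p"
  using hom_aeval[OF msubst.comm_ring_hom_axioms, of w mconst v p]
  by (simp add: msubst_def comm_ring_hom_mconst)

lemma meval_msubst: "meval a (msubst v p) = meval (\<lambda>i. meval a (v i)) p"
  using hom_aeval[OF meval.comm_ring_hom_axioms, of a mconst v p]
  by (simp add: msubst_def meval_def comm_ring_hom_id)

lemma msubst_cong: "(\<And>i. i \<in> mvars p \<Longrightarrow> v i = w i) \<Longrightarrow> msubst v p = msubst w p"
  unfolding msubst_def by (rule aeval_cong)

lemma meval_cong: "(\<And>i. i \<in> mvars p \<Longrightarrow> a i = b i) \<Longrightarrow> meval a p = meval b p"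
  unfolding meval_def by (rule aeval_cong)

lemma msubst_mvar_id [simp]: "msubst mvar p = p"
  by (induction p rule: mpoly_induct) (simp_all add: msubst.hom_add msubst.hom_mult)

lemma lookup_mconst_mult [simp]:
  "Poly_Mapping.lookup (mconst c * p) m = c * Poly_Mapping.lookup p m"
proof -
  have "mconst c * p = (\<Sum>m\<in>Poly_Mapping.keys p. Poly_Mapping.single m (c * Poly_Mapping.lookup p m))"
    by (subst mpoly_eq_sum_single[of p]) (simp add: sum_distrib_left mult_single mconst_def)
  then show ?thesis
    by (simp add: lookup_sum lookup_single when_def in_keys_iff)
qed

lemma mconst_mult_eq_0_iff [simp]: "mconst c * p = 0 \<longleftrightarrow> c = 0 \<or> p = 0"
  by (auto simp: poly_mapping_eq_iff fun_eq_iff)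

lemma mconst_eq_0_iff [simp]: "mconst c = 0 \<longleftrightarrow> c = 0"
  using mconst_mult_eq_0_iff[of c 1] by simp

lemma lookup_mvar_mult:
  "Poly_Mapping.lookup (mvar i * p) m =
    (if Poly_Mapping.lookup m i = 0 then 0
     else Poly_Mapping.lookup p (m - Poly_Mapping.single i 1))"
proof -
  have eq: "Poly_Mapping.single i 1 + m' = m \<longleftrightarrow>
      Poly_Mapping.lookup m i \<noteq> 0 \<and> m' = m - Poly_Mapping.single i 1" for m' :: "nat \<Rightarrow>\<^sub>0 nat"
  proof safe
    assume *: "0 < Poly_Mapping.lookup m i" "m' = m - Poly_Mapping.single i 1"
    then show "Poly_Mapping.single i 1 + (m - Poly_Mapping.single i 1) = m"
      by (intro poly_mapping_eqI) (auto simp: lookup_add lookup_minus lookup_single when_def)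
  qed (auto simp: lookup_add)
  have "mvar i * p = (\<Sum>m\<in>Poly_Mapping.keys p.
      Poly_Mapping.single (Poly_Mapping.single i 1 + m) (Poly_Mapping.lookup p m))"
    by (subst mpoly_eq_sum_single[of p]) (simp add: sum_distrib_left mult_mvar_single)
  then show ?thesis
    by (simp add: lookup_sum lookup_single when_def eq in_keys_iff del: One_nat_def)
qed

lemma lookup_mconst: "Poly_Mapping.lookup (mconst c) m = (if m = 0 then c else 0)"
  by (simp add: mconst_def lookup_single when_def)

section \<open>Forms\<close>

lemma mon_degree_add: "mon_degree (m + m') = mon_degree m + mon_degree m'"
proof -
  let ?A = "Poly_Mapping.keys m \<union> Poly_Mapping.keys m'"
  have *: "mon_degree k = (\<Sum>i\<in>?A. Poly_Mapping.lookup k i)" if "Poly_Mapping.keys k \<subseteq> ?A"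
    for k :: "nat \<Rightarrow>\<^sub>0 nat"
    unfolding mon_degree_def
    by (rule sum.mono_neutral_left) (use that in \<open>auto simp: in_keys_iff\<close>)
  show ?thesis
    by (simp add: * keys_add lookup_add sum.distrib)
qed

lemma mon_degree_single [simp]: "mon_degree (Poly_Mapping.single i k) = k"
  by (simp add: mon_degree_def)

lemma mon_degree_0 [simp]: "mon_degree 0 = 0"
  by (simp add: mon_degree_def)

lemma formsI:
  assumes "\<And>m. Poly_Mapping.lookup p m \<noteq> 0 \<Longrightarrow> Poly_Mapping.keys m \<subseteq> {..<n} \<and> mon_degree m = d"
  shows "p \<in> forms n d"
  using assms by (auto simp: forms_def mvars_def in_keys_iff)

lemma formsD:
  assumes "p \<in> forms n d" "Poly_Mapping.lookup p m \<noteq> 0"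
  shows "Poly_Mapping.keys m \<subseteq> {..<n}" "mon_degree m = d"
  using assms by (simp_all add: forms_def mvars_def in_keys_iff UN_subset_iff)

lemma mvars_forms: "p \<in> forms n d \<Longrightarrow> i \<in> mvars p \<Longrightarrow> i < n"
  by (auto simp: forms_def)

lemma forms_0 [simp, intro]: "0 \<in> forms n d"
  by (rule formsI) simp

lemma forms_add: "p \<in> forms n d \<Longrightarrow> q \<in> forms n d \<Longrightarrow> p + q \<in> forms n d"
  by (rule formsI) (metis lookup_add add.right_neutral formsD)

lemma forms_sum: "(\<And>x. x \<in> A \<Longrightarrow> f x \<in> forms n d) \<Longrightarrow> (\<Sum>x\<in>A. f x) \<in> forms n d"
  by (induction A rule: infinite_finite_induct) (auto intro: forms_add)

lemma forms_mconst [simp, intro]: "mconst c \<in> forms n 0"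
  by (rule formsI) (auto simp: lookup_mconst split: if_splits)

lemma forms_mvar [intro]: "i < n \<Longrightarrow> mvar i \<in> forms n 1"
  by (rule formsI) (auto simp: mvar_def lookup_single when_def split: if_splits)

lemma forms_mult:
  assumes "p \<in> forms n d" "q \<in> forms n e"
  shows "p * q \<in> forms n (d + e)"
proof (rule formsI)
  fix m
  assume "Poly_Mapping.lookup (p * q) m \<noteq> 0"
  then have "m \<in> Poly_Mapping.keys (p * q)" by (simp add: in_keys_iff)
  then obtain a b where "m = a + b" "Poly_Mapping.lookup p a \<noteq> 0" "Poly_Mapping.lookup q b \<noteq> 0"
    using keys_mult[of p q] by (auto simp: in_keys_iff)
  with formsD[OF assms(1), of a] formsD[OF assms(2), of b]
  show "Poly_Mapping.keys m \<subseteq> {..<n} \<and> mon_degree m = d + e"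
    using keys_add[of a b] by (auto simp: mon_degree_add)
qed

lemma forms_smult: "p \<in> forms n d \<Longrightarrow> mconst c * p \<in> forms n d"
  using forms_mult[OF forms_mconst] by fastforce

lemma forms_diff: "p \<in> forms n d \<Longrightarrow> q \<in> forms n d \<Longrightarrow> p - q \<in> forms n d"
  using forms_add[OF _ forms_smult[of q n d "-1"], of p] by (simp add: mconst.hom_uminus)

lemma forms_power: "p \<in> forms n d \<Longrightarrow> p ^ k \<in> forms n (d * k)"
proof (induction k)
  case 0
  show ?case using forms_mconst[of 1 n] by simp
qed (auto intro: forms_mult)

lemma forms_mono: "n \<le> n' \<Longrightarrow> forms n d \<subseteq> forms n' d"
  by (force simp: forms_def)

text \<open>
  Unlike the induction over all polynomials, this one keeps track of the degree, so it applies
  to statements such as homogeneity.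
\<close>

lemma forms_induct [consumes 1, case_names zero const add var_mult]:
  assumes "F \<in> forms n d"
    and zero: "\<And>d. P d 0"
    and const: "\<And>c. P 0 (mconst c)"
    and add: "\<And>d F G. F \<in> forms n d \<Longrightarrow> G \<in> forms n d \<Longrightarrow> P d F \<Longrightarrow> P d G \<Longrightarrow> P d (F + G)"
    and var: "\<And>d i F. i < n \<Longrightarrow> F \<in> forms n d \<Longrightarrow> P d F \<Longrightarrow> P (Suc d) (mvar i * F)"
  shows "P d F"
proof -
  have single: "Poly_Mapping.keys m \<subseteq> {..<n} \<Longrightarrow>
      Poly_Mapping.single m a \<in> forms n (mon_degree m) \<and> P (mon_degree m) (Poly_Mapping.single m a)"
    for m a
  proof (induction m rule: single_add_induct)
    case zero
    then show ?case using const[of a] forms_mconst[of a] by (simp add: mconst_def)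
  next
    case (add i m)
    have "Poly_Mapping.keys m \<subseteq> Poly_Mapping.keys (Poly_Mapping.single i 1 + m)"
      and "i \<in> Poly_Mapping.keys (Poly_Mapping.single i 1 + m)"
      by (auto simp: in_keys_iff lookup_add)
    with add.prems have i: "i < n" and "Poly_Mapping.keys m \<subseteq> {..<n}"
      by auto
    then have IH: "Poly_Mapping.single m a \<in> forms n (mon_degree m)"
        "P (mon_degree m) (Poly_Mapping.single m a)"
      using add by auto
    show ?case
      using var[OF i IH] forms_mult[OF forms_mvar[OF i] IH(1)]
      by (simp add: mult_mvar_single mon_degree_add)
  qed
  have "(\<Sum>m\<in>A. Poly_Mapping.single m (Poly_Mapping.lookup F m)) \<in> forms n d \<and>
      P d (\<Sum>m\<in>A. Poly_Mapping.single m (Poly_Mapping.lookup F m))"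
    if "finite A" "A \<subseteq> Poly_Mapping.keys F" for A
    using that
  proof induction
    case empty
    then show ?case using zero by simp
  next
    case (insert m A)
    have "Poly_Mapping.keys m \<subseteq> {..<n}" "mon_degree m = d"
      using insert.prems formsD[OF assms(1), of m] by (auto simp: in_keys_iff)
    with insert show ?case using single[of m] add by (auto intro: forms_add)
  qed
  from this[of "Poly_Mapping.keys F"] show ?thesis by (simp flip: mpoly_eq_sum_single)
qed

lemma forms_msubst:
  assumes "F \<in> forms r d" "\<And>i. i < r \<Longrightarrow> w i \<in> forms n 1"
  shows "msubst w F \<in> forms n d"
  using assms(1)
proof (induction rule: forms_induct)
  case (var_mult d i F)
  then show ?case using forms_mult[OF assms(2)[OF \<open>i < r\<close>]] by (fastforce simp: msubst.hom_mult)
qed (auto simp: msubst.hom_add intro: forms_add)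

lemma meval_homogeneous:
  assumes "F \<in> forms n d"
  shows "meval (\<lambda>i. c * a i) F = c ^ d * meval a F"
  using assms
  by (induction rule: forms_induct) (simp_all add: meval.hom_add meval.hom_mult algebra_simps)

section \<open>Linear forms\<close>

definition dot :: "nat \<Rightarrow> (nat \<Rightarrow> 'k::field) \<Rightarrow> (nat \<Rightarrow> 'k) \<Rightarrow> 'k" where
  "dot n a p = (\<Sum>i<n. a i * p i)"

text \<open>
  Linear forms are handled through their coefficient vectors, whose entries from
  \<open>n\<close> on are ignored. Points of the dual space, that is directions of
  differentiation, are represented in the same way, and \<open>dot\<close> is the pairing.
\<close>

definition lf :: "nat \<Rightarrow> (nat \<Rightarrow> 'k::field) \<Rightarrow> 'k mpoly" where
  "lf n a = (\<Sum>i<n. mconst (a i) * mvar i)"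

definition axis :: "nat \<Rightarrow> nat \<Rightarrow> 'k::field" where
  "axis j = (\<lambda>i. if i = j then 1 else 0)"

lemma axis_same: "axis j j = 1"
  by (simp add: axis_def)

lemma lf_forms [simp, intro]: "lf n a \<in> forms n 1"
  unfolding lf_def by (intro forms_sum forms_smult forms_mvar) auto

lemma lf_forms' [simp, intro]: "lf n a \<in> forms n (Suc 0)"
  using lf_forms by simp

lemma lookup_lf:
  "Poly_Mapping.lookup (lf n a) m = (\<Sum>i<n. if Poly_Mapping.single i 1 = m then a i else 0)"
  by (simp add: lf_def lookup_sum mvar_def lookup_single when_def if_distrib cong: if_cong)

lemma single_1_eq_iff: "Poly_Mapping.single i (1::nat) = Poly_Mapping.single j 1 \<longleftrightarrow> i = j"
  by (metis keys_single one_neq_zero singleton_inject)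

lemma lin_coords_lf: "lin_coords (lf n a) j = (if j < n then a j else 0)"
  by (simp add: lin_coords_def lookup_lf single_1_eq_iff del: One_nat_def)

lemma mon_degree_eq_0: "mon_degree m = 0 \<Longrightarrow> m = 0"
  by (induction m rule: single_add_induct) (auto simp: mon_degree_add)

lemma mon_degree_eq_1: "mon_degree m = 1 \<Longrightarrow> \<exists>i. m = Poly_Mapping.single i 1"
proof (induction m rule: single_add_induct)
  case (add i m)
  then have "m = 0" by (intro mon_degree_eq_0) (simp add: mon_degree_add)
  then show ?case by auto
qed simp

lemma lf_lin_coords:
  assumes "l \<in> forms n 1"
  shows "lf n (lin_coords l) = l"
proof (rule poly_mapping_eqI)
  fix m
  show "Poly_Mapping.lookup (lf n (lin_coords l)) m = Poly_Mapping.lookup l m"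
  proof (cases "\<exists>i<n. m = Poly_Mapping.single i 1")
    case True
    then show ?thesis
      by (auto simp: lookup_lf lin_coords_def single_1_eq_iff simp del: One_nat_def)
  next
    case False
    have "Poly_Mapping.lookup l m = 0"
    proof (rule ccontr)
      assume "Poly_Mapping.lookup l m \<noteq> 0"
      with formsD[OF assms] mon_degree_eq_1[of m] False show False by fastforce
    qed
    moreover have "Poly_Mapping.lookup (lf n (lin_coords l)) m = 0"
      unfolding lookup_lf by (rule sum.neutral) (use False in auto)
    ultimately show ?thesis by simp
  qed
qed

lemma lf_cong: "(\<And>i. i < n \<Longrightarrow> a i = b i) \<Longrightarrow> lf n a = lf n b"
  by (simp add: lf_def)

lemma lf_axis: "i < n \<Longrightarrow> lf n (axis i) = mvar i"
  by (simp add: lf_def axis_def if_distrib[of mconst] if_distrib[of "\<lambda>x. x * _"] cong: if_cong)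

lemma lf_zero [simp]: "lf n (\<lambda>i. 0) = 0"
  by (simp add: lf_def)

lemma lf_add: "lf n (\<lambda>i. a i + b i) = lf n a + lf n b"
  by (simp add: lf_def mconst.hom_add distrib_right sum.distrib)

lemma lf_smult: "lf n (\<lambda>i. c * a i) = mconst c * lf n a"
  by (simp add: lf_def mconst.hom_mult sum_distrib_left mult.assoc)

lemma lf_sum: "lf n (\<lambda>i. \<Sum>x\<in>A. f x i) = (\<Sum>x\<in>A. lf n (f x))"
  by (induction A rule: infinite_finite_induct) (simp_all add: lf_add)

lemma msubst_lf: "msubst w (lf N b) = (\<Sum>i<N. mconst (b i) * w i)"
  by (simp add: lf_def msubst.hom_sum msubst.hom_mult)

lemma msubst_lf_lf: "msubst (\<lambda>i. lf n (w i)) (lf N b) = lf n (\<lambda>j. \<Sum>i<N. b i * w i j)"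
  by (simp add: msubst_lf lf_sum lf_smult)

lemma meval_lf: "meval a (lf n b) = dot n b a"
  by (simp add: lf_def dot_def meval.hom_sum meval.hom_mult)

lemma dot_axis: "dot n a (axis i) = (if i < n then a i else 0)"
  by (simp add: dot_def axis_def if_distrib cong: if_cong)

lemma dot_add_left: "dot n (\<lambda>i. a i + t * b i) p = dot n a p + t * dot n b p"
  by (simp add: dot_def algebra_simps sum.distrib sum_distrib_left)

lemma dot_add_right: "dot n a (\<lambda>i. p i + t * q i) = dot n a p + t * dot n a q"
  by (simp add: dot_def algebra_simps sum.distrib sum_distrib_left)

lemma dot_smult_left: "dot n (\<lambda>i. t * b i) p = t * dot n b p"
  by (simp add: dot_def algebra_simps sum_distrib_left)

lemma dot_cong_right: "(\<And>i. i < n \<Longrightarrow> p i = q i) \<Longrightarrow> dot n a p = dot n a q"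
  by (simp add: dot_def)

lemma dot_axis_left: "dot n (axis i) p = (if i < n then p i else 0)"
  by (simp add: dot_def axis_def if_distrib[of "\<lambda>x. x * _"] cong: if_cong)

lemma dot_smult_right: "dot n a (\<lambda>i. t * p i) = t * dot n a p"
  by (simp add: dot_def algebra_simps sum_distrib_left)

lemma dot_commute: "dot n a p = dot n p a"
  by (simp add: dot_def mult.commute)

lemma msubst_lf_compose:
  "msubst (\<lambda>i. lf n (w i)) (msubst (\<lambda>i. lf r (u i)) F) =
    msubst (\<lambda>i. lf n (\<lambda>j. \<Sum>k<r. u i k * w k j)) F"
  by (simp add: msubst_msubst msubst_lf_lf)

lemma meval_cong_forms:
  "f \<in> forms n e \<Longrightarrow> (\<And>i. i < n \<Longrightarrow> a i = b i) \<Longrightarrow> meval a f = meval b f"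
  using mvars_forms by (intro meval_cong) blast

lemma msubst_cong_forms:
  "f \<in> forms n e \<Longrightarrow> (\<And>i. i < n \<Longrightarrow> v i = w i) \<Longrightarrow> msubst v f = msubst w f"
  using mvars_forms by (intro msubst_cong) blast

section \<open>Directional derivatives\<close>

text \<open>
  The coefficient of \<open>t\<close> in \<open>F(x + t p)\<close>. In this form the Leibniz
  rule is the multiplicativity of the substitution \<open>x \<mapsto> x + t p\<close>.
\<close>

definition dderiv :: "(nat \<Rightarrow> 'k::field) \<Rightarrow> 'k mpoly \<Rightarrow> 'k mpoly" where
  "dderiv p F = coeff (aeval (\<lambda>c. [:mconst c:]) (\<lambda>i. [:mvar i, mconst (p i):]) F) 1"

context
  fixes p :: "nat \<Rightarrow> 'k::field"
begin

interpretation shift: comm_ring_hom "aeval (\<lambda>c. [:mconst c:]) (\<lambda>i. [:mvar i, mconst (p i):])"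
  by (intro comm_ring_hom_aeval comm_ring_hom_poly_mconst)

lemma coeff_0_shift:
  "coeff (aeval (\<lambda>c. [:mconst c:]) (\<lambda>i. [:mvar i, mconst (p i):]) F) 0 = F"
  by (induction F rule: mpoly_induct)
    (simp_all add: comm_ring_hom_poly_mconst shift.hom_add shift.hom_mult coeff_mult)

lemma dderiv_mconst [simp]: "dderiv p (mconst c) = 0"
  by (simp add: dderiv_def comm_ring_hom_poly_mconst)

lemma dderiv_mvar [simp]: "dderiv p (mvar i) = mconst (p i)"
  by (simp add: dderiv_def comm_ring_hom_poly_mconst)

lemma dderiv_add: "dderiv p (F + G) = dderiv p F + dderiv p G"
  by (simp add: dderiv_def shift.hom_add)

lemma dderiv_mult: "dderiv p (F * G) = dderiv p F * G + F * dderiv p G"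
  by (simp add: dderiv_def shift.hom_mult coeff_mult coeff_0_shift algebra_simps)

lemma dderiv_0 [simp]: "dderiv p 0 = 0"
  by (simp add: dderiv_def)

lemma dderiv_diff: "dderiv p (F - G) = dderiv p F - dderiv p G"
  by (simp add: dderiv_def shift.hom_minus)

lemma dderiv_sum: "dderiv p (\<Sum>x\<in>A. f x) = (\<Sum>x\<in>A. dderiv p (f x))"
  by (induction A rule: infinite_finite_induct) (simp_all add: dderiv_add)

lemma dderiv_smult: "dderiv p (mconst c * F) = mconst c * dderiv p F"
  by (simp add: dderiv_mult)

lemma dderiv_power: "dderiv p (F ^ Suc k) = of_nat (Suc k) * F ^ k * dderiv p F"
  by (induction k) (simp_all add: dderiv_mult algebra_simps)

lemma dderiv_lf [simp]: "dderiv p (lf n a) = mconst (dot n a p)"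
  by (simp add: lf_def dderiv_sum dderiv_smult dot_def mconst.hom_sum mconst.hom_mult)

lemma dderiv_forms:
  assumes "F \<in> forms n d"
  shows "dderiv p F \<in> forms n (d - 1)"
proof -
  have "dderiv p F \<in> forms n (d - 1) \<and> (d = 0 \<longrightarrow> dderiv p F = 0)"
    using assms
  proof (induction rule: forms_induct)
    case (var_mult d i F)
    then have "mvar i * dderiv p F \<in> forms n d"
      using forms_mult[OF forms_mvar[of i n], of "dderiv p F" "d - 1"]
      by (cases d) auto
    with var_mult show ?case
      by (auto simp: dderiv_mult intro: forms_add forms_smult)
  qed (auto simp: dderiv_add intro: forms_add)
  then show ?thesis ..
qed

end

lemma dderiv_cong: "(\<And>i. i \<in> mvars F \<Longrightarrow> p i = q i) \<Longrightarrow> dderiv p F = dderiv q F"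
  unfolding dderiv_def by (intro arg_cong[where f = "\<lambda>P. coeff P 1"] aeval_cong) simp

lemma dderiv_cong_forms:
  "F \<in> forms n d \<Longrightarrow> (\<And>i. i < n \<Longrightarrow> p i = q i) \<Longrightarrow> dderiv p F = dderiv q F"
  using mvars_forms by (intro dderiv_cong) blast

lemma dderiv_add_dir:
  "dderiv (\<lambda>i. p i + t * v i) F = dderiv p F + mconst t * dderiv v F"
  by (induction F rule: mpoly_induct)
    (simp_all add: dderiv_add dderiv_mult mconst.hom_add mconst.hom_mult algebra_simps)

lemma dderiv_zero_dir [simp]: "dderiv (\<lambda>i. 0) F = 0"
  by (induction F rule: mpoly_induct) (simp_all add: dderiv_add dderiv_mult)

lemma dderiv_smult_dir: "dderiv (\<lambda>i. t * v i) F = mconst t * dderiv v F"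
  using dderiv_add_dir[of "\<lambda>i. 0" t v F] by simp

lemma dderiv_commute: "dderiv p (dderiv q F) = dderiv q (dderiv p F)"
  by (induction F rule: mpoly_induct) (simp_all add: dderiv_add dderiv_mult algebra_simps)

lemma dderiv_sum_dir: "dderiv (\<lambda>i. \<Sum>x\<in>A. v x i) F = (\<Sum>x\<in>A. dderiv (v x) F)"
proof (induction A rule: infinite_finite_induct)
  case (insert x A)
  then show ?case using dderiv_add_dir[of "v x" 1 "\<lambda>i. \<Sum>x\<in>A. v x i" F] by simp
qed simp_all

lemma dderiv_eq_sum_axis:
  assumes "F \<in> forms n d"
  shows "dderiv p F = (\<Sum>i<n. mconst (p i) * dderiv (axis i) F)"
proof -
  have "dderiv p F = dderiv (\<lambda>j. \<Sum>i<n. p i * axis i j) F"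
    using assms by (intro dderiv_cong_forms[OF assms])
      (simp add: axis_def if_distrib cong: if_cong)
  then show ?thesis
    by (simp add: dderiv_sum_dir dderiv_smult_dir)
qed

text \<open>
  The chain rule for a substitution \<open>w\<close> that is affine along \<open>q\<close>: the
  direction \<open>q\<close> is carried to \<open>p\<close>.
\<close>

lemma dderiv_msubst:
  assumes "\<And>i. dderiv q (w i) = mconst (p i)"
  shows "dderiv q (msubst w F) = msubst w (dderiv p F)"
  by (induction F rule: mpoly_induct)
    (simp_all add: dderiv_add dderiv_mult msubst.hom_add msubst.hom_mult assms)

lemma dderiv_msubst_lf:
  "dderiv q (msubst (\<lambda>i. lf n (w i)) F) = msubst (\<lambda>i. lf n (w i)) (dderiv (\<lambda>i. dot n (w i) q) F)"
  by (rule dderiv_msubst) simp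

text \<open>
  The explicit formula connects derivatives with the set of occurring variables, which is how
  characteristic \<open>0\<close> enters.
\<close>

lemma lookup_dderiv_axis:
  "Poly_Mapping.lookup (dderiv (axis j) F) m =
    of_nat (Suc (Poly_Mapping.lookup m j)) * Poly_Mapping.lookup F (m + Poly_Mapping.single j 1)"
proof (induction F arbitrary: m rule: mpoly_induct)
  case (const c)
  have "m + Poly_Mapping.single j 1 \<noteq> 0"
    by (metis add_eq_0_iff_both_eq_0 lookup_add lookup_single_eq lookup_zero one_neq_zero)
  then show ?case by (simp add: lookup_mconst)
next
  case (add F G)
  then show ?case by (simp add: dderiv_add lookup_add algebra_simps)
next
  case (var_mult i F)
  show ?case
  proof (cases "i = j")
    case True
    have "m - Poly_Mapping.single j 1 + Poly_Mapping.single j 1 = m" if "Poly_Mapping.lookup m j \<noteq> 0"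
      using that by (intro poly_mapping_eqI) (auto simp: lookup_add lookup_minus lookup_single when_def)
    with True show ?thesis
      by (auto simp: dderiv_mult var_mult axis_same lookup_add lookup_mvar_mult lookup_minus
          distrib_right simp del: One_nat_def)
  next
    case False
    have "m - Poly_Mapping.single i 1 + Poly_Mapping.single j 1 =
        m + Poly_Mapping.single j 1 - Poly_Mapping.single i 1" if "Poly_Mapping.lookup m i \<noteq> 0"
      using that False
      by (intro poly_mapping_eqI) (auto simp: lookup_add lookup_minus lookup_single when_def)
    with False var_mult show ?thesis
      by (auto simp: dderiv_mult axis_def lookup_add lookup_mvar_mult lookup_minus lookup_single
          when_def simp del: One_nat_def)
  qed
qed

lemma dderiv_axis_eq_0_iff:
  fixes F :: "'k::field_char_0 mpoly"
  shows "dderiv (axis j) F = 0 \<longleftrightarrow> j \<notin> mvars F"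
proof
  assume *: "dderiv (axis j) F = 0"
  show "j \<notin> mvars F"
  proof
    assume "j \<in> mvars F"
    then obtain m where m: "Poly_Mapping.lookup F m \<noteq> 0" "Poly_Mapping.lookup m j \<noteq> 0"
      by (auto simp: mvars_def in_keys_iff)
    have "m - Poly_Mapping.single j 1 + Poly_Mapping.single j 1 = m"
      using m by (intro poly_mapping_eqI) (auto simp: lookup_add lookup_minus lookup_single when_def)
    then have "of_nat (Suc (Poly_Mapping.lookup (m - Poly_Mapping.single j 1) j)) *
        Poly_Mapping.lookup F m = 0"
      using * lookup_dderiv_axis[of j F "m - Poly_Mapping.single j 1"] by simp
    with m show False by (simp del: of_nat_Suc)
  qed
next
  assume *: "j \<notin> mvars F"
  have "Poly_Mapping.lookup F (m + Poly_Mapping.single j 1) = 0" for m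
  proof (rule ccontr)
    assume "Poly_Mapping.lookup F (m + Poly_Mapping.single j 1) \<noteq> 0"
    then have "j \<in> mvars F"
      by (auto simp: mvars_def in_keys_iff lookup_add intro!: bexI[of _ "m + Poly_Mapping.single j 1"])
    with * show False by simp
  qed
  then show "dderiv (axis j) F = 0"
    by (intro poly_mapping_eqI) (simp add: lookup_dderiv_axis)
qed

text \<open>
  A monomial of positive degree contains some variable, and differentiating by that variable
  does not kill it in characteristic \<open>0\<close>.
\<close>

lemma forms_eq_0I:
  fixes F :: "'k::field_char_0 mpoly"
  assumes "F \<in> forms n d" "d \<ge> 1" "\<And>j. j < n \<Longrightarrow> dderiv (axis j) F = 0"
  shows "F = 0"
proof (rule poly_mapping_eqI, rule ccontr)
  fix m
  assume "Poly_Mapping.lookup F m \<noteq> Poly_Mapping.lookup 0 m"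
  then have m: "Poly_Mapping.lookup F m \<noteq> 0" by simp
  then have "mon_degree m \<noteq> 0" using formsD(2)[OF assms(1) m] assms(2) by simp
  then obtain i where "i \<in> Poly_Mapping.keys m"
    by (metis mon_degree_def sum.empty ex_in_conv)
  then have "i \<in> mvars F" using m by (auto simp: mvars_def in_keys_iff)
  with assms(3)[OF mvars_forms[OF assms(1) this]] show False
    by (simp add: dderiv_axis_eq_0_iff)
qed

section \<open>Forms that essentially depend on all variables\<close>

text \<open>
  The differential form of essential dependence on all variables: a change of coordinates that
  removes the variable \<open>x\<^sub>z\<close> is the same as a direction, the
  \<open>z\<close>-th column of the matrix, in which the derivative vanishes.
\<close>

definition nondegenerate :: "nat \<Rightarrow> 'k::field mpoly \<Rightarrow> bool" where
  "nondegenerate n F \<longleftrightarrow> (\<forall>p. dderiv p F = 0 \<longrightarrow> (\<forall>i<n. p i = 0))"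

lemma msubst_lf_inverse:
  assumes "F \<in> forms n d"
    and "\<And>i k. i < n \<Longrightarrow> k < n \<Longrightarrow> (\<Sum>j<n. a i j * b j k) = (if i = k then 1 else 0)"
  shows "msubst (\<lambda>i. lf n (b i)) (msubst (\<lambda>i. lf n (a i)) F) = F"
proof -
  have "msubst (\<lambda>i. lf n (b i)) (msubst (\<lambda>i. lf n (a i)) F) = msubst mvar F"
    unfolding msubst_lf_compose
  proof (rule msubst_cong_forms[OF assms(1)])
    fix i assume "i < n"
    then have "lf n (\<lambda>j. \<Sum>k<n. a i k * b k j) = lf n (axis i)"
      by (intro lf_cong) (auto simp: assms(2) axis_def)
    with \<open>i < n\<close> show "lf n (\<lambda>j. \<Sum>k<n. a i k * b k j) = mvar i" by (simp add: lf_axis)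
  qed
  then show ?thesis by simp
qed

context
  fixes p :: "nat \<Rightarrow> 'k::field" and z :: nat
begin

text \<open>
  The identity matrix with its column \<open>z\<close> replaced by \<open>p\<close>, and its
  inverse: the simplest coordinate change that carries the axis \<open>z\<close> to the
  direction \<open>p\<close>.
\<close>

definition to_axis :: "nat \<Rightarrow> nat \<Rightarrow> 'k" where
  "to_axis i j = (if j = z then p i else if i = j then 1 else 0)"

definition from_axis :: "nat \<Rightarrow> nat \<Rightarrow> 'k" where
  "from_axis i j = (if j = z then (if i = z then 1 / p z else - p i / p z)
    else if i = j then 1 else 0)"

lemma to_from_axis:
  assumes "z < n" "p z \<noteq> 0" "i < n" "k < n"
  shows "(\<Sum>j<n. to_axis i j * from_axis j k) = (if i = k then 1 else 0)"
proof -
  have "(\<Sum>j<n. to_axis i j * from_axis j k) =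
      p i * from_axis z k + (\<Sum>j\<in>{..<n}-{z}. to_axis i j * from_axis j k)"
    using assms by (subst sum.remove[of _ z]) (auto simp: to_axis_def)
  also have "(\<Sum>j\<in>{..<n}-{z}. to_axis i j * from_axis j k) =
      (\<Sum>j\<in>{..<n}-{z}. if i = j then from_axis j k else 0)"
    by (intro sum.cong) (auto simp: to_axis_def)
  also have "\<dots> = (if i = z then 0 else from_axis i k)"
    using assms by simp
  finally show ?thesis
    using assms by (auto simp: from_axis_def)
qed

lemma from_to_axis:
  assumes "z < n" "p z \<noteq> 0" "i < n" "k < n"
  shows "(\<Sum>j<n. from_axis i j * to_axis j k) = (if i = k then 1 else 0)"
proof -
  have "(\<Sum>j<n. from_axis i j * to_axis j k) =
      from_axis i z * to_axis z k + (\<Sum>j\<in>{..<n}-{z}. from_axis i j * to_axis j k)"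
    using assms by (subst sum.remove[of _ z]) auto
  also have "(\<Sum>j\<in>{..<n}-{z}. from_axis i j * to_axis j k) =
      (\<Sum>j\<in>{..<n}-{z}. if i = j then to_axis j k else 0)"
    by (intro sum.cong) (auto simp: from_axis_def)
  also have "\<dots> = (if i = z then 0 else to_axis i k)"
    using assms by simp
  finally show ?thesis
    using assms by (auto simp: from_axis_def to_axis_def)
qed

end

lemma mvars_to_axis:
  fixes F :: "'k::field_char_0 mpoly"
  assumes "F \<in> forms n d" "dderiv p F = 0" "z < n"
  shows "z \<notin> mvars (msubst (\<lambda>i. lf n (to_axis p z i)) F)"
proof -
  have "dderiv (axis z) (msubst (\<lambda>i. lf n (to_axis p z i)) F) =
      msubst (\<lambda>i. lf n (to_axis p z i)) (dderiv (\<lambda>i. dot n (to_axis p z i) (axis z)) F)"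
    by (rule dderiv_msubst_lf)
  also have "dderiv (\<lambda>i. dot n (to_axis p z i) (axis z)) F = 0"
    using assms by (simp add: dot_axis to_axis_def)
  finally show ?thesis by (simp flip: dderiv_axis_eq_0_iff)
qed

text \<open>
  Renumbering of the variables after the removal of the variable \<open>z\<close>.
\<close>

lemma bij_betw_skip_index:
  fixes z n :: nat
  assumes "z < n"
  shows "bij_betw (\<lambda>i. if i < z then i else Suc i) {..<n-1} ({..<n} - {z})"
proof (rule bij_betw_imageI)
  show "inj_on (\<lambda>i. if i < z then i else Suc i) {..<n-1}"
    by (rule inj_onI) (simp split: if_splits)
  show "(\<lambda>i. if i < z then i else Suc i) ` {..<n-1} = {..<n} - {z}"
  proof (intro equalityI subsetI)
    fix i assume "i \<in> {..<n} - {z}"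
    then show "i \<in> (\<lambda>i. if i < z then i else Suc i) ` {..<n-1}"
      using assms by (intro image_eqI[of _ _ "if i < z then i else i - 1"]) (simp_all, linarith+)
  next
    fix i assume "i \<in> (\<lambda>i. if i < z then i else Suc i) ` {..<n-1}"
    then obtain j where "j < n - 1" "i = (if j < z then j else Suc j)" by blast
    then show "i \<in> {..<n} - {z}" using assms by (simp split: if_splits)
  qed
qed

text \<open>
  After the coordinate change that carries the axis \<open>z\<close> to \<open>p\<close>, the
  form no longer contains \<open>x\<^sub>z\<close>. Undoing the change with
  \<open>x\<^sub>z\<close> set to \<open>0\<close> rewrites \<open>F\<close> in the linear forms
  \<open>x\<^sub>i - (p\<^sub>i / p\<^sub>z) x\<^sub>z\<close> for \<open>i \<noteq> z\<close>,
  which are a basis of the space of linear forms vanishing at \<open>p\<close>.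
\<close>

lemma dderiv_eq_0_imp_fewer_variables:
  fixes F :: "'k::field_char_0 mpoly"
  assumes F: "F \<in> forms n d" and "dderiv p F = 0" and z: "z < n" "p z \<noteq> 0"
  shows "\<exists>F'\<in>forms (n - 1) d. \<exists>w. F = msubst (\<lambda>i. lf n (w i)) F' \<and>
    (\<forall>a. dot n a p = 0 \<longrightarrow> (\<exists>c. \<forall>j<n. a j = (\<Sum>i<n-1. c i * w i j)))"
proof -
  let ?A = "to_axis p z" and ?B = "from_axis p z"
  define \<tau> where "\<tau> i = (if i < z then i else Suc i)" for i
  define \<sigma> where "\<sigma> i = (if i < z then i else i - 1)" for i
  have \<tau>\<sigma>: "\<tau> (\<sigma> i) = i" if "i \<noteq> z" for i
    using that by (auto simp: \<tau>_def \<sigma>_def)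
  define \<xi> where "\<xi> i = (if i = z then 0 else mvar (\<sigma> i) :: 'k mpoly)" for i
  have F': "msubst \<xi> F \<in> forms (n - 1) d"
  proof (rule forms_msubst[OF F])
    fix i assume "i < n"
    then show "\<xi> i \<in> forms (n - 1) 1"
      using z by (auto simp: \<xi>_def \<sigma>_def simp del: One_nat_def intro!: forms_mvar)
  qed
  define G where "G = msubst (\<lambda>i. lf n (?A i)) F"
  define \<beta> where "\<beta> i = (if i = z then 0 else lf n (?B i))" for i
  have "F = msubst (\<lambda>i. lf n (?B i)) G"
    unfolding G_def by (rule msubst_lf_inverse[symmetric, OF F]) (rule to_from_axis[where p = p and z = z, OF z])
  also have "\<dots> = msubst \<beta> G"
    unfolding \<beta>_def using mvars_to_axis[OF assms(1-3)] by (intro msubst_cong) (auto simp: G_def)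
  also have "\<dots> = msubst (\<lambda>i. msubst \<beta> (lf n (?A i))) F"
    by (simp add: G_def msubst_msubst)
  also have "\<dots> = msubst \<beta> F"
  proof (rule msubst_cong_forms[OF F])
    fix i assume "i < n"
    have "msubst \<beta> (lf n (?A i)) = (\<Sum>j<n. if j = i then \<beta> i else 0)"
      unfolding msubst_lf by (intro sum.cong) (auto simp: \<beta>_def to_axis_def)
    with \<open>i < n\<close> show "msubst \<beta> (lf n (?A i)) = \<beta> i" by simp
  qed
  also have "\<dots> = msubst (\<lambda>i. lf n (?B (\<tau> i))) (msubst \<xi> F)"
    unfolding msubst_msubst by (intro msubst_cong) (auto simp: \<beta>_def \<xi>_def \<tau>\<sigma>)
  finally have eq: "F = msubst (\<lambda>i. lf n (?B (\<tau> i))) (msubst \<xi> F)" .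
  have bij: "bij_betw \<tau> {..<n-1} ({..<n} - {z})"
    unfolding \<tau>_def by (rule bij_betw_skip_index[OF z(1)])
  have "\<exists>c. \<forall>j<n. a j = (\<Sum>i<n-1. c i * ?B (\<tau> i) j)" if a: "dot n a p = 0" for a
  proof (intro exI[of _ "\<lambda>i. a (\<tau> i)"] allI impI)
    fix j assume j: "j < n"
    have "(\<Sum>i<n-1. a (\<tau> i) * ?B (\<tau> i) j) = (\<Sum>k\<in>{..<n} - {z}. a k * ?B k j)"
      using sum.reindex_bij_betw[OF bij, of "\<lambda>k. a k * ?B k j"] .
    also have "\<dots> = a j"
    proof (cases "j = z")
      case True
      have "(\<Sum>k\<in>{..<n} - {z}. a k * ?B k j) = (\<Sum>k\<in>{..<n} - {z}. a k * p k * (- 1 / p z))"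
        by (intro sum.cong) (auto simp: True from_axis_def)
      also have "\<dots> = (\<Sum>k\<in>{..<n} - {z}. a k * p k) * (- 1 / p z)"
        by (rule sum_distrib_right[symmetric])
      also have "(\<Sum>k\<in>{..<n} - {z}. a k * p k) = dot n a p - a z * p z"
        using sum.remove[of "{..<n}" z "\<lambda>k. a k * p k"] z by (simp add: dot_def)
      finally show ?thesis
        using z unfolding a True by simp
    next
      case False
      then have "(\<Sum>k\<in>{..<n} - {z}. a k * ?B k j) = (\<Sum>k\<in>{..<n} - {z}. if k = j then a k else 0)"
        by (intro sum.cong) (auto simp: from_axis_def)
      with False j show ?thesis by simp
    qed
    finally show "a j = (\<Sum>i<n-1. a (\<tau> i) * ?B (\<tau> i) j)" by (rule sym)
  qed
  then show ?thesis
    using F' eq by (intro bexI[of _ "msubst \<xi> F"] exI[of _ "\<lambda>i. ?B (\<tau> i)"] conjI allI impI)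
qed

lemma lin_change_eq:
  assumes "F \<in> forms n d"
  shows "lin_change n A F = msubst (\<lambda>i. lf n (\<lambda>j. A $$ (i, j))) F"
  by (simp add: lin_change_def lf_def)

theorem essentially_depends_iff_nondegenerate:
  fixes F :: "'k::field_char_0 mpoly"
  assumes F: "F \<in> forms n d"
  shows "essentially_depends n F \<longleftrightarrow> nondegenerate n F"
proof
  assume ess: "essentially_depends n F"
  show "nondegenerate n F"
    unfolding nondegenerate_def
  proof (intro allI impI, rule ccontr)
    fix p z assume p: "dderiv p F = 0" and z: "z < n" "p z \<noteq> 0"
    define A B where "A = mat n n (\<lambda>(i, j). to_axis p z i j)"
      and "B = mat n n (\<lambda>(i, j). from_axis p z i j)"
    have "A * B = 1\<^sub>m n" "B * A = 1\<^sub>m n"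
      using to_from_axis[where p = p and z = z, OF z] from_to_axis[where p = p and z = z, OF z]
      by (auto simp: A_def B_def scalar_prod_def lessThan_atLeast0[symmetric] intro!: eq_matI)
    then have "invertible_mat A"
      unfolding invertible_mat_def inverts_mat_def
      by (intro conjI exI[of _ B]) (auto simp: A_def B_def)
    moreover have "lin_change n A F = msubst (\<lambda>i. lf n (to_axis p z i)) F"
      unfolding lin_change_eq[OF F]
      by (rule msubst_cong_forms[OF F]) (auto simp: A_def intro!: lf_cong)
    then have "mvars (lin_change n A F) \<subseteq> {..<n} - {z}"
      using mvars_to_axis[OF F p z(1)]
        mvars_forms[OF forms_msubst[OF F, of "\<lambda>i. lf n (to_axis p z i)" n]] by auto
    then have "card (mvars (lin_change n A F)) \<le> card ({..<n} - {z})"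
      by (intro card_mono) auto
    then have "card (mvars (lin_change n A F)) < n" using z by simp
    ultimately show False
      using ess by (auto simp: essentially_depends_def A_def)
  qed
next
  assume nd: "nondegenerate n F"
  show "essentially_depends n F"
    unfolding essentially_depends_def
  proof
    assume "\<exists>A\<in>carrier_mat n n. invertible_mat A \<and> card (mvars (lin_change n A F)) < n"
    then obtain A where A: "A \<in> carrier_mat n n" "invertible_mat A"
      and card: "card (mvars (lin_change n A F)) < n" by blast
    then obtain B where B: "inverts_mat A B" "inverts_mat B A"
      unfolding invertible_mat_def by blast
    have "dim_col B = n" using A(1) arg_cong[OF B(1)[unfolded inverts_mat_def], of dim_col] by simp
    moreover have "dim_row B = n"
      using A(1) arg_cong[OF B(2)[unfolded inverts_mat_def], of dim_col] by simp
    ultimately have Bc: "B \<in> carrier_mat n n" by blast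
    have entry: "(X * Y) $$ (i, k) = (\<Sum>j<n. X $$ (i, j) * Y $$ (j, k))"
      if "X \<in> carrier_mat n n" "Y \<in> carrier_mat n n" "i < n" "k < n" for X Y :: "'k mat" and i k
      using that by (simp add: scalar_prod_def atLeast0LessThan)
    have "A * B = 1\<^sub>m n" "B * A = 1\<^sub>m n"
      using B A(1) Bc unfolding inverts_mat_def by auto
    then have AB: "(\<Sum>j<n. A $$ (i, j) * B $$ (j, k)) = (if i = k then 1 else 0)"
      and BA: "(\<Sum>j<n. B $$ (i, j) * A $$ (j, k)) = (if i = k then 1 else 0)"
      if "i < n" "k < n" for i k
      using entry[OF A(1) Bc that] entry[OF Bc A(1) that] that by simp_all
    let ?G = "lin_change n A F"
    have "\<not> {..<n} \<subseteq> mvars ?G"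
    proof
      assume "{..<n} \<subseteq> mvars ?G"
      moreover have "finite (mvars ?G)" by (simp add: mvars_def)
      ultimately have "n \<le> card (mvars ?G)" using card_mono[of "mvars ?G" "{..<n}"] by simp
      with card show False by simp
    qed
    then obtain z where z: "z < n" "z \<notin> mvars ?G" by blast
    define q where "q i = A $$ (i, z)" for i
    have dF: "dderiv q F \<in> forms n (d - 1)" by (rule dderiv_forms[OF F])
    have "0 = dderiv (axis z) ?G" using z(2) by (simp add: dderiv_axis_eq_0_iff)
    also have "\<dots> = msubst (\<lambda>i. lf n (\<lambda>j. A $$ (i, j)))
        (dderiv (\<lambda>i. dot n (\<lambda>j. A $$ (i, j)) (axis z)) F)"
      unfolding lin_change_eq[OF F] by (rule dderiv_msubst_lf)
    also have "(\<lambda>i. dot n (\<lambda>j. A $$ (i, j)) (axis z)) = q"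
      using z(1) by (simp add: dot_axis q_def fun_eq_iff)
    finally have "msubst (\<lambda>i. lf n (\<lambda>j. A $$ (i, j))) (dderiv q F) = 0" by (rule sym)
    moreover have "dderiv q F =
        msubst (\<lambda>i. lf n (\<lambda>j. B $$ (i, j))) (msubst (\<lambda>i. lf n (\<lambda>j. A $$ (i, j))) (dderiv q F))"
      by (rule msubst_lf_inverse[symmetric, OF dF]) (rule AB)
    ultimately have "dderiv q F = 0" by (simp only: msubst.hom_zero)
    then have "q i = 0" if "i < n" for i
      using nd[unfolded nondegenerate_def, rule_format, of q] that by simp
    then have "(\<Sum>j<n. B $$ (z, j) * A $$ (j, z)) = 0" by (simp add: q_def)
    with BA[OF z(1) z(1)] show False by simp
  qed
qed

text \<open>
  Directions in which the derivative vanishes are split off one at a time.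
\<close>

lemma nondegenerate_reduction:
  fixes F :: "'k::field_char_0 mpoly"
  assumes "F \<in> forms n d"
  shows "\<exists>r\<le>n. \<exists>F'\<in>forms r d. nondegenerate r F' \<and> (\<exists>u. F = msubst (\<lambda>i. lf n (u i)) F')"
  using assms
proof (induction n arbitrary: F rule: less_induct)
  case (less n)
  show ?case
  proof (cases "nondegenerate n F")
    case True
    have "msubst (\<lambda>i. lf n (axis i)) F = msubst mvar F"
      by (rule msubst_cong_forms[OF less(2)]) (rule lf_axis)
    then have "F = msubst (\<lambda>i. lf n (axis i)) F" by simp
    then show ?thesis
      by (intro exI[of _ n] conjI order_refl bexI[OF _ less(2)] exI[of _ axis] True)
  next
    case False
    then obtain p z where pz: "dderiv p F = 0" "z < n" "p z \<noteq> 0"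
      by (auto simp: nondegenerate_def)
    obtain F1 w where F1: "F1 \<in> forms (n - 1) d" "F = msubst (\<lambda>i. lf n (w i)) F1"
      using dderiv_eq_0_imp_fewer_variables[where p = p and z = z, OF less(2) pz]
      by (elim exE conjE bexE) (rule that)
    have "n - 1 < n" using \<open>z < n\<close> by simp
    from less(1)[OF this F1(1)] obtain r F' u where r: "r \<le> n - 1" "F' \<in> forms r d"
      "nondegenerate r F'" and F': "F1 = msubst (\<lambda>i. lf (n - 1) (u i)) F'"
      by (elim exE conjE bexE) (rule that)
    have "F = msubst (\<lambda>i. lf n (\<lambda>j. \<Sum>k<n-1. u i k * w k j)) F'"
      unfolding F1(2) F' by (rule msubst_lf_compose)
    moreover have "r \<le> n" using r(1) by simp
    ultimately show ?thesis
      using r(2,3)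
      by (intro exI[of _ r] conjI bexI[of _ F'] exI[of _ "\<lambda>i j. \<Sum>k<n-1. u i k * w k j"])
  qed
qed

section \<open>Sums of powers off a hypersurface\<close>

text \<open>
  A decomposition into \<open>d\<close>-th powers of linear forms whose coefficient vectors lie
  off the hypersurface \<open>f = 0\<close>.
\<close>

definition power_sum_off :: "nat \<Rightarrow> nat \<Rightarrow> 'k::field mpoly \<Rightarrow> nat \<Rightarrow> 'k mpoly \<Rightarrow> bool" where
  "power_sum_off n d f m F \<longleftrightarrow>
    (\<exists>a. (\<forall>i<m. meval (a i) f \<noteq> 0) \<and> F = (\<Sum>i<m. lf n (a i) ^ d))"

text \<open>
  The bound \<open>Ork n d \<le> M\<close> with the suprema and infima unfolded. Only
  hypersurfaces appear: a proper closed set is contained in one, and enlarging the closed set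
  makes decompositions rarer.
\<close>

definition ork_le :: "'k::field itself \<Rightarrow> nat \<Rightarrow> nat \<Rightarrow> nat \<Rightarrow> bool" where
  "ork_le _ n d M \<longleftrightarrow>
    (\<forall>F\<in>forms n d. nondegenerate n F \<longrightarrow>
      (\<forall>e. \<forall>f::'k mpoly\<in>forms n e. (\<exists>b. meval b f \<noteq> 0) \<longrightarrow> (\<exists>m\<le>M. power_sum_off n d f m F)))"

lemma ork_leD:
  assumes "ork_le TYPE('k::field) n d M" "F \<in> forms n d" "nondegenerate n F"
    "(f :: 'k mpoly) \<in> forms n e" "meval b f \<noteq> 0"
  shows "\<exists>m\<le>M. power_sum_off n d f m F"
  using assms unfolding ork_le_def by blast

lemma Inf_enat_le_imp_mem:
  assumes "Inf A \<le> enat M"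
  shows "\<exists>m\<le>M. enat m \<in> A"
proof -
  have "A \<noteq> {}"
  proof
    assume "A = {}"
    with assms show False by (simp add: top_enat_def)
  qed
  then have "Inf A \<in> A"
    unfolding Inf_enat_def by (auto intro: LeastI)
  moreover obtain m where m: "Inf A = enat m" "m \<le> M"
    using assms by (cases "Inf A") auto
  ultimately show ?thesis by auto
qed

lemma power_sum_off_imp_Ork_avoiding_le:
  assumes "power_sum_off n d f m F" "f \<in> forms n e"
    and "\<And>l. l \<in> V \<Longrightarrow> meval (lin_coords l) f = 0"
  shows "Ork_avoiding n d F V \<le> enat m"
proof -
  obtain a where a: "\<forall>i<m. meval (a i) f \<noteq> 0" "F = (\<Sum>i<m. lf n (a i) ^ d)"
    using assms(1) by (auto simp: power_sum_off_def)
  have "lf n (a i) \<in> forms n 1 - V" if "i < m" for i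
  proof -
    have "meval (lin_coords (lf n (a i))) f = meval (a i) f"
      by (rule meval_cong_forms[OF assms(2)]) (simp add: lin_coords_lf)
    with a(1) that assms(3) show ?thesis by auto
  qed
  with a(2) show ?thesis
    unfolding Ork_avoiding_def
    by (intro Inf_lower CollectI exI[of _ m] conjI refl exI[of _ "\<lambda>i. lf n (a i)"]) auto
qed

lemma Ork_avoiding_zero_set_le_imp_power_sum_off:
  assumes "Ork_avoiding n d F {l \<in> forms n 1. meval (lin_coords l) f = 0} \<le> enat M"
    and "f \<in> forms n e"
  shows "\<exists>m\<le>M. power_sum_off n d f m F"
proof -
  obtain m l where m: "m \<le> M" "\<forall>i<m. l i \<in> forms n 1 - {l \<in> forms n 1. meval (lin_coords l) f = 0}"
    "F = (\<Sum>i<m. l i ^ d)"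
    using Inf_enat_le_imp_mem[OF assms(1)[unfolded Ork_avoiding_def]] by auto
  have "power_sum_off n d f m F"
    unfolding power_sum_off_def
  proof (intro exI[of _ "\<lambda>i. lin_coords (l i)"] conjI allI impI)
    show "F = (\<Sum>i<m. lf n (lin_coords (l i)) ^ d)"
      unfolding m(3) using m(2) by (intro sum.cong) (auto simp: lf_lin_coords)
  qed (use m(2) in auto)
  with m(1) show ?thesis by blast
qed

lemma homogeneous_closed_zero_set:
  assumes "f \<in> forms n e" "meval b f \<noteq> 0"
  shows "homogeneous_closed n {l \<in> forms n 1. meval (lin_coords l) f = 0}"
    and "{l \<in> forms n 1. meval (lin_coords l) f = 0} \<subset> forms n 1"
proof -
  show "homogeneous_closed n {l \<in> forms n 1. meval (lin_coords l) f = 0}"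
    unfolding homogeneous_closed_def using assms(1) by (intro exI[of _ "{f}"]) auto
  have "meval (lin_coords (lf n b)) f = meval b f"
    by (rule meval_cong_forms[OF assms(1)]) (simp add: lin_coords_lf)
  then have "lf n b \<in> forms n 1 - {l \<in> forms n 1. meval (lin_coords l) f = 0}"
    using assms(2) by auto
  then show "{l \<in> forms n 1. meval (lin_coords l) f = 0} \<subset> forms n 1"
    by blast
qed

theorem Ork_le_iff:
  "Ork TYPE('k::field_char_0) n d \<le> enat M \<longleftrightarrow> ork_le TYPE('k) n d M"
proof
  assume le: "Ork TYPE('k) n d \<le> enat M"
  show "ork_le TYPE('k) n d M"
    unfolding ork_le_def
  proof (intro ballI allI impI)
    fix F f :: "'k mpoly" and e
    assume F: "F \<in> forms n d" "nondegenerate n F" and f: "f \<in> forms n e" "\<exists>b. meval b f \<noteq> 0"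
    then obtain b where b: "meval b f \<noteq> 0" by blast
    let ?V = "{l \<in> forms n 1. meval (lin_coords l) f = 0}"
    have "Ork_avoiding n d F ?V \<le> Ork_form n d F"
      unfolding Ork_form_def using homogeneous_closed_zero_set[OF f(1) b]
      by (intro Sup_upper) blast
    also have "\<dots> \<le> Ork TYPE('k) n d"
      unfolding Ork_def using F essentially_depends_iff_nondegenerate[OF F(1)]
      by (intro Sup_upper) blast
    finally show "\<exists>m\<le>M. power_sum_off n d f m F"
      using Ork_avoiding_zero_set_le_imp_power_sum_off[OF _ f(1)] le by (meson order_trans)
  qed
next
  assume le: "ork_le TYPE('k) n d M"
  have *: "Ork_avoiding n d F V \<le> enat M"
    if F: "F \<in> forms n d" "essentially_depends n F"
      and V: "V \<subset> forms n 1" "homogeneous_closed n V" for F :: "'k mpoly" and V :: "'k mpoly set"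
  proof -
    obtain P where P: "P \<subseteq> (\<Union>e. forms n e)" "V = {l \<in> forms n 1. \<forall>p\<in>P. meval (lin_coords l) p = 0}"
      using V(2) by (auto simp: homogeneous_closed_def)
    obtain l where "l \<in> forms n 1" "l \<notin> V" using V(1) by blast
    then obtain p e where p: "p \<in> P" "p \<in> forms n e" "meval (lin_coords l) p \<noteq> 0"
      using P by blast
    obtain m where "m \<le> M" "power_sum_off n d p m F"
      using ork_leD[OF le F(1) _ p(2,3)] F essentially_depends_iff_nondegenerate[OF F(1)] by blast
    moreover from this p P(2) have "Ork_avoiding n d F V \<le> enat m"
      by (intro power_sum_off_imp_Ork_avoiding_le[of n d p m F e]) auto
    ultimately show "Ork_avoiding n d F V \<le> enat M"
      by (meson enat_ord_simps(1) order_trans)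
  qed
  show "Ork TYPE('k) n d \<le> enat M"
    unfolding Ork_def
  proof (rule Sup_least)
    fix x assume "x \<in> {Ork_form n d F |F :: 'k mpoly. F \<in> forms n d \<and> essentially_depends n F}"
    then obtain F :: "'k mpoly" where x: "x = Ork_form n d F"
      and F: "F \<in> forms n d" "essentially_depends n F" by blast
    show "x \<le> enat M"
      unfolding x Ork_form_def
      by (rule Sup_least, elim CollectE exE conjE) (simp only: *[OF F])
  qed
qed

lemma sum_lessThan_add:
  fixes m m' :: nat
  shows "(\<Sum>i<m + m'. f i) = (\<Sum>i<m. f i) + (\<Sum>i<m'. f (m + i) :: 'a::comm_monoid_add)"
  by (induction m') (simp_all add: add.assoc)

lemma power_sum_off_add:
  assumes "power_sum_off n d f m F" "power_sum_off n d f m' G"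
  shows "power_sum_off n d f (m + m') (F + G)"
proof -
  obtain a b where "\<forall>i<m. meval (a i) f \<noteq> 0" "F = (\<Sum>i<m. lf n (a i) ^ d)"
    "\<forall>i<m'. meval (b i) f \<noteq> 0" "G = (\<Sum>i<m'. lf n (b i) ^ d)"
    using assms by (auto simp: power_sum_off_def)
  then show ?thesis
    unfolding power_sum_off_def
    by (intro exI[of _ "\<lambda>i. if i < m then a i else b (i - m)"]) (auto simp: sum_lessThan_add)
qed

lemma power_sum_off_sum:
  assumes "\<And>i. i < m \<Longrightarrow> meval (a i) f \<noteq> 0"
  shows "power_sum_off n d f m (\<Sum>i<m. lf n (a i) ^ d)"
  unfolding power_sum_off_def using assms by blast

lemma meval_msubst_lf:
  "meval c (msubst (\<lambda>j. lf N (\<lambda>i. w i j)) f) = meval (\<lambda>j. \<Sum>k<N. c k * w k j) f"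
  by (simp add: meval_msubst meval_lf dot_def mult.commute)

text \<open>
  A linear substitution turns powers of linear forms into powers of linear forms, and those that
  avoid the preimage of the hypersurface go to linear forms that avoid the hypersurface.
\<close>

lemma power_sum_off_msubst:
  assumes "power_sum_off N d (msubst (\<lambda>j. lf N (\<lambda>i. w i j)) f) m H"
  shows "power_sum_off n d f m (msubst (\<lambda>i. lf n (w i)) H)"
proof -
  obtain a where a: "\<forall>i<m. meval (\<lambda>j. \<Sum>k<N. a i k * w k j) f \<noteq> 0"
    "H = (\<Sum>i<m. lf N (a i) ^ d)"
    using assms by (auto simp: power_sum_off_def meval_msubst_lf)
  have "msubst (\<lambda>i. lf n (w i)) H = (\<Sum>i<m. lf n (\<lambda>j. \<Sum>k<N. a i k * w k j) ^ d)"
    by (simp add: a(2) msubst.hom_sum msubst.hom_power msubst_lf_lf)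
  with a(1) show ?thesis by (auto simp: power_sum_off_def)
qed

text \<open>
  For \<open>d \<ge> 2\<close>, differentiating twice, first by a new variable
  \<open>x\<^sub>i\<close>, isolates \<open>p\<^sub>i\<close>; then only the nondegenerate
  summand is left.
\<close>

lemma nondegenerate_add_powers:
  fixes R :: "'k::field_char_0 mpoly"
  assumes R: "R \<in> forms r d" "nondegenerate r R" and "d \<ge> 2"
  shows "nondegenerate N (R + (\<Sum>i=r..<N. mvar i ^ d))"
  unfolding nondegenerate_def
proof (intro allI impI)
  let ?H = "R + (\<Sum>i=r..<N. mvar i ^ d)"
  fix p i assume p: "dderiv p ?H = 0" and "i < N"
  obtain k where d: "d = Suc (Suc k)" using \<open>d \<ge> 2\<close> by (metis Suc_le_D numeral_2_eq_2 Suc_le_mono)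
  have dH: "dderiv q ?H = dderiv q R + (\<Sum>i=r..<N. of_nat d * mvar i ^ (d - 1) * mconst (q i))" for q
    unfolding d by (simp only: dderiv_add dderiv_sum dderiv_power dderiv_mvar diff_Suc_1)
  have large: "p i = 0" if i: "i \<in> {r..<N}" for i
  proof -
    have "i \<notin> mvars R" using mvars_forms[OF R(1)] i by fastforce
    then have "dderiv (axis i) R = 0" by (simp add: dderiv_axis_eq_0_iff)
    then have "dderiv (axis i) ?H = (\<Sum>j=r..<N. if j = i then of_nat d * mvar i ^ (d - 1) else 0)"
      unfolding dH by (simp add: axis_def if_distrib[of mconst] if_distrib[of "\<lambda>x. _ * x"]
          cong: if_cong)
    also have "\<dots> = mconst (of_nat d) * mvar i ^ Suc k"
      using i by (simp add: d mconst.hom_of_nat del: of_nat_Suc)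
    finally have "dderiv p (mconst (of_nat d) * mvar i ^ Suc k) = dderiv p (dderiv (axis i) ?H)"
      by simp
    also have "\<dots> = dderiv (axis i) (dderiv p ?H)" by (rule dderiv_commute)
    also have "\<dots> = 0" by (simp add: p)
    finally have "mconst (of_nat d) * (of_nat (Suc k) * mvar i ^ k * mconst (p i)) = 0"
      by (simp only: dderiv_smult dderiv_power dderiv_mvar)
    then have "meval (\<lambda>_. 1) (mconst (of_nat d) * (of_nat (Suc k) * mvar i ^ k * mconst (p i))) = 0"
      by (simp only: meval.hom_zero)
    then have "of_nat d * (of_nat (Suc k) * p i) = 0"
      by (simp add: meval.hom_mult meval.hom_of_nat meval.hom_power del: of_nat_Suc)
    then show "p i = 0" by (simp add: d del: of_nat_Suc)
  qed
  have "dderiv p R = 0"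
    using p large unfolding dH by simp
  then have "\<forall>i<r. p i = 0"
    using R(2)[unfolded nondegenerate_def, rule_format, of p] by simp
  with large \<open>i < N\<close> show "p i = 0" by (cases "i < r") auto
qed

text \<open>
  The bound for nondegenerate forms in \<open>N\<close> variables is made available to
  degenerate ones. Powers of the missing variables are added, and the decomposition of the
  resulting nondegenerate form is pulled along a substitution \<open>w\<close>. The values of
  \<open>w\<close> at the missing variables can be chosen freely, as long as the image of
  \<open>w\<close> is not contained in the hypersurface.
\<close>

lemma ork_le_msubst_add_powers:
  fixes R :: "'k::field_char_0 mpoly"
  assumes ork: "ork_le TYPE('k) N d M" and "d \<ge> 2"
    and R: "R \<in> forms r d" "nondegenerate r R" "r \<le> N"
    and f: "f \<in> forms n e" "meval (\<lambda>j. \<Sum>k<N. c k * w k j) f \<noteq> 0"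
  shows "\<exists>m\<le>M. power_sum_off n d f m
    (msubst (\<lambda>i. lf n (w i)) R + (\<Sum>i=r..<N. lf n (w i) ^ d))"
proof -
  let ?H = "R + (\<Sum>i=r..<N. mvar i ^ d)"
  have "mvar i ^ d \<in> forms N d" if "i < N" for i
    using forms_power[OF forms_mvar[OF that], of d] by simp
  then have "?H \<in> forms N d"
    using forms_mono[OF R(3)] R(1) by (intro forms_add forms_sum) auto
  moreover have "nondegenerate N ?H"
    using R(1,2) \<open>d \<ge> 2\<close> by (rule nondegenerate_add_powers)
  moreover have "msubst (\<lambda>j. lf N (\<lambda>i. w i j)) f \<in> forms N e"
    by (rule forms_msubst[OF f(1)]) auto
  moreover have "meval c (msubst (\<lambda>j. lf N (\<lambda>i. w i j)) f) \<noteq> 0"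
    using f(2) by (simp add: meval_msubst_lf)
  ultimately obtain m where m: "m \<le> M"
    "power_sum_off N d (msubst (\<lambda>j. lf N (\<lambda>i. w i j)) f) m ?H"
    using ork_leD[OF ork] by blast
  have "msubst (\<lambda>i. lf n (w i)) ?H = msubst (\<lambda>i. lf n (w i)) R + (\<Sum>i=r..<N. lf n (w i) ^ d)"
    by (simp add: msubst.hom_add msubst.hom_sum msubst.hom_power)
  with m(1) power_sum_off_msubst[OF m(2), of n] show ?thesis by auto
qed

text \<open>
  A power of a linear form off the hypersurface is absorbed at no cost if there is a spare
  variable: that variable is sent to the linear form, and the image is then certainly not
  contained in the hypersurface.
\<close>

lemma ork_le_absorb_power:
  fixes R :: "'k::field_char_0 mpoly"
  assumes ork: "ork_le TYPE('k) N d M" and "d \<ge> 2" and R: "R \<in> forms r d" "r + 1 \<le> N"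
    and f: "f \<in> forms n e" "meval b f \<noteq> 0"
  shows "\<exists>m\<le>M. power_sum_off n d f m (msubst (\<lambda>i. lf n (w i)) R + lf n b ^ d)"
proof -
  obtain s R' u where R': "s \<le> r" "R' \<in> forms s d" "nondegenerate s R'"
    and eq: "R = msubst (\<lambda>i. lf r (u i)) R'"
    using nondegenerate_reduction[OF R(1)] by (elim exE conjE bexE) (rule that)
  define v where "v k = (if k < s then (\<lambda>j. \<Sum>i<r. u k i * w i j) else if k = s then b else (\<lambda>_. 0))" for k
  have "s < N" using R'(1) R(2) by simp
  have "(\<Sum>k<N. axis s k * v k j) = (\<Sum>k<N. if k = s then b j else 0)" for j
    by (intro sum.cong) (auto simp: axis_def v_def)
  then have "meval (\<lambda>j. \<Sum>k<N. axis s k * v k j) f \<noteq> 0"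
    using \<open>s < N\<close> f(2) by simp
  from ork_le_msubst_add_powers[OF ork \<open>d \<ge> 2\<close> R'(2,3) _ f(1) this] \<open>s < N\<close>
  obtain m where m: "m \<le> M"
    "power_sum_off n d f m (msubst (\<lambda>i. lf n (v i)) R' + (\<Sum>i=s..<N. lf n (v i) ^ d))"
    by auto
  have "msubst (\<lambda>i. lf n (v i)) R' = msubst (\<lambda>i. lf n (w i)) R"
    unfolding eq msubst_lf_compose by (rule msubst_cong_forms[OF R'(2)]) (simp add: v_def)
  moreover have "(\<Sum>i=s..<N. lf n (v i) ^ d) = (\<Sum>i=s..<N. if i = s then lf n b ^ d else 0)"
    using \<open>d \<ge> 2\<close> by (intro sum.cong) (auto simp: v_def)
  ultimately show ?thesis
    using m \<open>s < N\<close> by auto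
qed

text \<open>
  The two spare variables bring the image off the hypersurface without a trace in the form: they
  are sent to \<open>l\<close> and \<open>\<zeta> l\<close>, where \<open>l\<close> lies off the
  hypersurface and \<open>\<zeta>\<^sup>d = -1\<close>, so that the two added powers cancel.
\<close>

lemma ork_le_two_spare_variables:
  fixes R :: "'k::{alg_closed_field,field_char_0} mpoly"
  assumes ork: "ork_le TYPE('k) N d M" and "d \<ge> 2" and R: "R \<in> forms r d" "r + 2 \<le> N"
    and f: "f \<in> forms n e" "meval b f \<noteq> 0"
  shows "\<exists>m\<le>M. power_sum_off n d f m (msubst (\<lambda>i. lf n (w i)) R)"
proof -
  obtain \<zeta> :: 'k where \<zeta>: "\<zeta> ^ d = -1"
    using nth_root_exists[of d "-1"] \<open>d \<ge> 2\<close> by auto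
  obtain s R' u where R': "s \<le> r" "R' \<in> forms s d" "nondegenerate s R'"
    and eq: "R = msubst (\<lambda>i. lf r (u i)) R'"
    using nondegenerate_reduction[OF R(1)] by (elim exE conjE bexE) (rule that)
  define v where "v k = (if k < s then (\<lambda>j. \<Sum>i<r. u k i * w i j) else if k = s then b
    else if k = Suc s then (\<lambda>j. \<zeta> * b j) else (\<lambda>_. 0))" for k
  have s: "s < N" "Suc s < N" using R'(1) R(2) by simp_all
  have "(\<Sum>k<N. axis s k * v k j) = (\<Sum>k<N. if k = s then b j else 0)" for j
    by (intro sum.cong) (auto simp: axis_def v_def)
  then have "meval (\<lambda>j. \<Sum>k<N. axis s k * v k j) f \<noteq> 0"
    using \<open>s < N\<close> f(2) by simp
  from ork_le_msubst_add_powers[OF ork \<open>d \<ge> 2\<close> R'(2,3) _ f(1) this] \<open>s < N\<close>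
  obtain m where m: "m \<le> M"
    "power_sum_off n d f m (msubst (\<lambda>i. lf n (v i)) R' + (\<Sum>i=s..<N. lf n (v i) ^ d))"
    by auto
  have "msubst (\<lambda>i. lf n (v i)) R' = msubst (\<lambda>i. lf n (w i)) R"
    unfolding eq msubst_lf_compose by (rule msubst_cong_forms[OF R'(2)]) (simp add: v_def)
  moreover have "(\<Sum>i=s..<N. lf n (v i) ^ d) =
      (\<Sum>i=s..<N. (if i = s then lf n b ^ d else 0) + (if i = Suc s then - (lf n b ^ d) else 0))"
    using \<open>d \<ge> 2\<close>
    by (intro sum.cong)
      (auto simp: v_def lf_smult power_mult_distrib \<zeta> mconst.hom_uminus simp flip: mconst.hom_power)
  then have "(\<Sum>i=s..<N. lf n (v i) ^ d) = 0"
    using s by (simp add: sum.distrib)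
  ultimately show ?thesis
    using m by auto
qed

section \<open>Generic points\<close>

text \<open>
  The part of Zariski openness that is needed for choosing a generic point: a line through a
  point of the set leaves the set only finitely often. Any two nonempty such sets meet, on the
  line that joins a point of one with a point of the other.
\<close>

definition line_open :: "(nat \<Rightarrow> 'k::field) set \<Rightarrow> bool" where
  "line_open U \<longleftrightarrow> (\<forall>u\<in>U. \<forall>v. finite {t. (\<lambda>i. u i + t * v i) \<notin> U})"

lemma line_open_UNIV: "line_open UNIV"
  by (simp add: line_open_def)

lemma line_open_Int:
  assumes "line_open U" "line_open V"
  shows "line_open (U \<inter> V)"
  unfolding line_open_def
proof (intro ballI allI)
  fix u v assume u: "u \<in> U \<inter> V"
  have "finite ({t. (\<lambda>i. u i + t * v i) \<notin> U} \<union> {t. (\<lambda>i. u i + t * v i) \<notin> V})"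
    using assms u by (simp add: line_open_def)
  then show "finite {t. (\<lambda>i. u i + t * v i) \<notin> U \<inter> V}"
    by (rule rev_finite_subset) auto
qed

lemma line_open_meet:
  fixes u v :: "nat \<Rightarrow> 'k::field_char_0"
  assumes "line_open U" "line_open V" "u \<in> U" "v \<in> V"
  shows "\<exists>t. (\<lambda>i. u i + t * (v i - u i)) \<in> U \<inter> V"
proof -
  let ?l = "\<lambda>t i. u i + t * (v i - u i)"
  have 1: "finite {t. ?l t \<notin> U}"
    by (rule assms(1)[unfolded line_open_def, rule_format, OF assms(3)])
  have "finite {t. (\<lambda>i. v i + t * (u i - v i)) \<notin> V}"
    by (rule assms(2)[unfolded line_open_def, rule_format, OF assms(4)])
  then have "finite ((\<lambda>t. 1 - t) ` {t. (\<lambda>i. v i + t * (u i - v i)) \<notin> V})"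
    by (rule finite_imageI)
  moreover have "{t. ?l t \<notin> V} \<subseteq> (\<lambda>t. 1 - t) ` {t. (\<lambda>i. v i + t * (u i - v i)) \<notin> V}"
  proof
    fix t assume "t \<in> {t. ?l t \<notin> V}"
    moreover have "(\<lambda>i. v i + (1 - t) * (u i - v i)) = ?l t"
      by (simp add: fun_eq_iff algebra_simps)
    ultimately show "t \<in> (\<lambda>t. 1 - t) ` {t. (\<lambda>i. v i + t * (u i - v i)) \<notin> V}"
      by (intro image_eqI[of _ _ "1 - t"]) simp_all
  qed
  ultimately have 2: "finite {t. ?l t \<notin> V}" by (rule rev_finite_subset)
  have "finite ({t. ?l t \<notin> U} \<union> {t. ?l t \<notin> V})" using 1 2 by simp
  then have "\<exists>t. t \<notin> {t. ?l t \<notin> U} \<union> {t. ?l t \<notin> V}"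
    using ex_new_if_finite infinite_UNIV_char_0 by blast
  then show ?thesis by blast
qed

lemma line_open_Inter:
  fixes \<U> :: "(nat \<Rightarrow> 'k::field_char_0) set set"
  assumes "finite \<U>" "\<And>U. U \<in> \<U> \<Longrightarrow> line_open U \<and> U \<noteq> {}"
  shows "\<Inter>\<U> \<noteq> {}"
proof -
  have "line_open (\<Inter>\<U>) \<and> \<Inter>\<U> \<noteq> {}"
    using assms
  proof induction
    case (insert U \<U>)
    then have "line_open U" "line_open (\<Inter>\<U>)" "U \<noteq> {}" "\<Inter>\<U> \<noteq> {}" by auto
    with line_open_Int[of U "\<Inter>\<U>"] line_open_meet[of U "\<Inter>\<U>"] show ?case
      by (metis Inter_insert ex_in_conv)
  qed (simp add: line_open_UNIV)
  then show ?thesis by simp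
qed

lemma comm_ring_hom_poly_eval: "comm_ring_hom (\<lambda>P. poly P (t::'k::comm_ring_1))"
  by unfold_locales simp_all

lemma meval_on_line:
  "\<exists>P. \<forall>t. poly P t = meval (\<lambda>j. a j + t * c j) f"
proof (intro exI allI)
  fix t
  show "poly (aeval (\<lambda>c. [:c:]) (\<lambda>j. [:a j, c j:]) f) t = meval (\<lambda>j. a j + t * c j) f"
    using hom_aeval[OF comm_ring_hom_poly_eval[of t], of "\<lambda>c. [:c:]" "\<lambda>j. [:a j, c j:]" f]
    by (simp add: meval_def)
qed

lemma line_open_if_poly:
  assumes "\<And>u v. u \<in> U \<Longrightarrow> \<exists>P. poly P 0 \<noteq> 0 \<and> (\<forall>t. poly P t \<noteq> 0 \<longrightarrow> (\<lambda>i. u i + t * v i) \<in> U)"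
  shows "line_open U"
  unfolding line_open_def
proof (intro ballI allI)
  fix u v assume "u \<in> U"
  then obtain P where P: "poly P 0 \<noteq> 0" "\<forall>t. poly P t \<noteq> 0 \<longrightarrow> (\<lambda>i. u i + t * v i) \<in> U"
    using assms by blast
  then have "finite {t. poly P t = 0}" by (intro poly_roots_finite) auto
  then show "finite {t. (\<lambda>i. u i + t * v i) \<notin> U}"
    by (rule rev_finite_subset) (use P(2) in auto)
qed

lemma line_open_meval_neq_0:
  assumes "\<And>u t v j. c (\<lambda>i. u i + t * v i) j = c u j + t * c v j"
  shows "line_open {u. meval (c u) f \<noteq> 0}"
proof (rule line_open_if_poly)
  fix u v assume u: "u \<in> {u. meval (c u) f \<noteq> 0}"
  obtain P where P: "\<forall>t. poly P t = meval (\<lambda>j. c u j + t * c v j) f"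
    using meval_on_line by blast
  have "c (\<lambda>i. u i + t * v i) = (\<lambda>j. c u j + t * c v j)" for t
    by (rule ext) (rule assms)
  with P u show "\<exists>P. poly P 0 \<noteq> 0 \<and>
      (\<forall>t. poly P t \<noteq> 0 \<longrightarrow> (\<lambda>i. u i + t * v i) \<in> {u. meval (c u) f \<noteq> 0})"
    by (intro exI[of _ P]) simp
qed

lemma line_open_mpoly_neq_0:
  fixes \<phi> :: "(nat \<Rightarrow> 'k::field) \<Rightarrow> 'k mpoly"
  assumes "\<And>u v t. \<phi> (\<lambda>i. u i + t * v i) = \<phi> u + mconst t * \<psi> u v + mconst (t ^ 2) * \<chi> u v"
  shows "line_open {u. \<phi> u \<noteq> 0}"
proof (rule line_open_if_poly)
  fix u v assume "u \<in> {u. \<phi> u \<noteq> 0}"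
  then obtain m where m: "Poly_Mapping.lookup (\<phi> u) m \<noteq> 0"
    by (auto simp: poly_mapping_eq_iff fun_eq_iff)
  let ?P = "[:Poly_Mapping.lookup (\<phi> u) m, Poly_Mapping.lookup (\<psi> u v) m,
    Poly_Mapping.lookup (\<chi> u v) m:]"
  have P: "poly ?P t = Poly_Mapping.lookup (\<phi> (\<lambda>i. u i + t * v i)) m" for t
    by (simp add: assms lookup_add power2_eq_square distrib_left mult.assoc)
  have "poly ?P 0 \<noteq> 0" using m by simp
  moreover have "\<phi> (\<lambda>i. u i + t * v i) \<noteq> 0" if "poly ?P t \<noteq> 0" for t
    using that unfolding P by auto
  ultimately show "\<exists>P. poly P 0 \<noteq> 0 \<and>
      (\<forall>t. poly P t \<noteq> 0 \<longrightarrow> (\<lambda>i. u i + t * v i) \<in> {u. \<phi> u \<noteq> 0})"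
    by (intro exI[of _ ?P]) simp
qed

lemma two_forms_nonzero_on_line:
  fixes a b :: "nat \<Rightarrow> 'k::field_char_0"
  assumes "meval a f \<noteq> 0" "meval b g \<noteq> 0"
  shows "\<exists>t. meval (\<lambda>i. a i + t * (b i - a i)) f \<noteq> 0 \<and> meval (\<lambda>i. a i + t * (b i - a i)) g \<noteq> 0"
proof -
  have "line_open {u. meval u f \<noteq> 0}" "line_open {u. meval u g \<noteq> 0}"
    by (intro line_open_meval_neq_0; rule refl)+
  from line_open_meet[OF this, of a b] assms show ?thesis by simp
qed

section \<open>Hyperplanes in a hypersurface\<close>

text \<open>
  Normalise the normal vectors \<open>q\<close> by \<open>q \<cdot> b = 1\<close> for a point
  \<open>b\<close> off the hypersurface. If \<open>q\<^sub>i \<noteq> 0\<close>, the line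
  \<open>b + t e\<^sub>i\<close> meets the hyperplane at \<open>t = -1 / q\<^sub>i\<close>,
  which must be one of the finitely many roots of \<open>f\<close> on that line.
\<close>

lemma finite_hyperplanes_in_hypersurface:
  assumes f: "meval b f \<noteq> 0"
  shows "finite {q. (\<forall>i. i \<notin> {..<n} \<longrightarrow> q i = 0) \<and> dot n b q = 1 \<and>
    (\<forall>a. dot n a q = 0 \<longrightarrow> meval a f = 0)}" (is "finite ?Q")
proof -
  let ?T = "\<lambda>i. {t. meval (\<lambda>j. b j + t * axis i j) f = 0}"
  have "finite (?T i)" for i
  proof -
    obtain P where P: "\<forall>t. poly P t = meval (\<lambda>j. b j + t * axis i j) f"
      using meval_on_line by blast
    have "poly P 0 \<noteq> 0" using P f by simp
    then have "finite {t. poly P t = 0}" by (intro poly_roots_finite) auto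
    then show ?thesis by (simp add: P)
  qed
  then have fin: "finite (insert 0 (\<Union>i<n. (\<lambda>t. - 1 / t) ` ?T i))" (is "finite ?S")
    by simp
  have "?Q \<subseteq> {q. \<forall>i. (i \<in> {..<n} \<longrightarrow> q i \<in> ?S) \<and> (i \<notin> {..<n} \<longrightarrow> q i = 0)}"
  proof
    fix q assume "q \<in> ?Q"
    then have q0: "\<And>i. i \<notin> {..<n} \<Longrightarrow> q i = 0" and q1: "dot n b q = 1"
      and q: "\<And>a. dot n a q = 0 \<Longrightarrow> meval a f = 0" by auto
    have "q i \<in> ?S" if i: "i < n" for i
    proof (cases "q i = 0")
      case False
      have "dot n (\<lambda>j. b j + - 1 / q i * axis i j) q = 0"
        using i False by (simp only: dot_add_left dot_axis_left q1) simp
      then have "- 1 / q i \<in> ?T i" using q by blast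
      then have "- 1 / (- 1 / q i) \<in> (\<lambda>t. - 1 / t) ` ?T i" by (rule imageI)
      moreover have "- 1 / (- 1 / q i) = q i" using False by simp
      ultimately show ?thesis using i by auto
    qed simp
    with q0 show "q \<in> {q. \<forall>i. (i \<in> {..<n} \<longrightarrow> q i \<in> ?S) \<and> (i \<notin> {..<n} \<longrightarrow> q i = 0)}"
      by simp
  qed
  moreover have "finite {q. \<forall>i. (i \<in> {..<n} \<longrightarrow> q i \<in> ?S) \<and> (i \<notin> {..<n} \<longrightarrow> q i = 0)}"
    by (rule finite_set_of_finite_funs[OF _ fin]) simp
  ultimately show ?thesis by (rule finite_subset)
qed

section \<open>Integrating a decomposition\<close>

text \<open>
  Integration of a decomposition of the derivative. The remainder \<open>R\<close> after
  subtracting the integrated powers is killed by the derivative, hence lives in \<open>n -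
  1\<close> variables. If it is nondegenerate there, it is decomposed directly, and the point
  \<open>a\<close> shows that the hyperplane of its variables is not contained in the
  hypersurface. Otherwise a variable is spare, and one of the integrated powers is decomposed
  together with \<open>R\<close>, which does not change the bound.
\<close>

lemma power_sum_off_from_dderiv:
  fixes F :: "'k::{alg_closed_field,field_char_0} mpoly"
  assumes F: "F \<in> forms n d" and "d \<ge> 2" "n \<ge> 2" and f: "f \<in> forms n e"
    and a: "dot n a p = 0" "meval a f \<noteq> 0"
    and dF: "dderiv p F = (\<Sum>i<m. lf n (l i) ^ (d - 1))" and "m \<ge> 1"
    and l: "\<And>i. i < m \<Longrightarrow> meval (l i) f \<noteq> 0" "\<And>i. i < m \<Longrightarrow> dot n (l i) p \<noteq> 0"
    and ork: "ork_le TYPE('k) (n - 1) d M"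
  shows "\<exists>m'\<le>M + m. power_sum_off n d f m' F"
proof -
  obtain k where d: "d = Suc k" using \<open>d \<ge> 2\<close> by (cases d) auto
  \<comment> \<open>The factor by which \<open>l\<^sub>i\<close> is scaled so that \<open>\<partial>\<^sub>p\<close> of its \<open>d\<close>-th power is \<open>l\<^sub>i\<^bsup>d-1\<^esup>\<close>.\<close>
  have "\<exists>c. c ^ d = 1 / (of_nat d * dot n (l i) p)" for i
    using nth_root_exists[of d "1 / (of_nat d * dot n (l i) p)"] \<open>d \<ge> 2\<close> by auto
  then obtain c where c: "\<And>i. c i ^ d = 1 / (of_nat d * dot n (l i) p)" by metis
  have dl: "of_nat d * dot n (l i) p \<noteq> 0" if "i < m" for i
    using l(2)[OF that] \<open>d \<ge> 2\<close> by simp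
  define b where "b i = (\<lambda>j. c i * l i j)" for i
  have c0: "c i \<noteq> 0" if "i < m" for i
  proof
    assume "c i = 0"
    with c[of i] l(2)[OF that] show False by (simp add: d del: of_nat_Suc)
  qed
  have b: "meval (b i) f \<noteq> 0" if "i < m" for i
    using c0[OF that] l(1)[OF that] by (simp add: b_def meval_homogeneous[OF f])
  have db: "dderiv p (lf n (b i) ^ d) = lf n (l i) ^ (d - 1)" if "i < m" for i
  proof -
    have "dderiv p (lf n (b i) ^ d) =
        mconst (of_nat d * c i ^ d * dot n (l i) p) * lf n (l i) ^ k"
      unfolding b_def d dderiv_power lf_smult
      by (simp only: dderiv_smult dderiv_lf power_mult_distrib mconst.hom_mult mconst.hom_power
          mconst.hom_of_nat power_Suc mult_ac)
    also have "of_nat d * c i ^ d * dot n (l i) p = (of_nat d * dot n (l i) p) * c i ^ d"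
      by (simp only: mult_ac)
    also have "\<dots> = 1"
      unfolding c using dl[OF that]
      by (simp only: times_divide_eq_right mult_1_right divide_self not_False_eq_True)
    finally show ?thesis by (simp add: d)
  qed
  define R where "R = F - (\<Sum>i<m. lf n (b i) ^ d)"
  have "lf n (b i) ^ d \<in> forms n d" for i
    using forms_power[OF lf_forms, of n "b i" d] by simp
  then have R: "R \<in> forms n d"
    unfolding R_def by (intro forms_diff[OF F] forms_sum)
  have "(\<Sum>i<m. dderiv p (lf n (b i) ^ d)) = (\<Sum>i<m. lf n (l i) ^ (d - 1))"
    by (rule sum.cong[OF refl]) (simp only: db lessThan_iff)
  then have dR: "dderiv p R = 0"
    unfolding R_def dderiv_diff dderiv_sum dF by (simp only: diff_self)
  have "\<exists>z<n. p z \<noteq> 0"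
  proof (rule ccontr)
    assume "\<nexists>z. z < n \<and> p z \<noteq> 0"
    then have "dot n (l 0) p = 0" by (simp add: dot_def)
    with l(2)[of 0] \<open>m \<ge> 1\<close> show False by simp
  qed
  then obtain z where z: "z < n" "p z \<noteq> 0" by blast
  obtain R1 w where R1: "R1 \<in> forms (n - 1) d" and Rw: "R = msubst (\<lambda>i. lf n (w i)) R1"
    and w: "\<forall>a. dot n a p = 0 \<longrightarrow> (\<exists>c. \<forall>j<n. a j = (\<Sum>i<n-1. c i * w i j))"
    using dderiv_eq_0_imp_fewer_variables[where p = p and z = z, OF R dR z]
    by (elim exE conjE bexE) (rule that)
  show ?thesis
  proof (cases "nondegenerate (n - 1) R1")
    case True
    obtain g where g: "\<forall>j<n. a j = (\<Sum>i<n-1. g i * w i j)"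
      using w[rule_format, OF a(1)] by (elim exE) (rule that)
    have "meval (\<lambda>j. \<Sum>i<n-1. g i * w i j) f = meval a f"
      by (rule meval_cong_forms[OF f]) (use g in auto)
    then obtain m1 where m1: "m1 \<le> M" "power_sum_off n d f m1 R"
      using ork_le_msubst_add_powers[OF ork \<open>d \<ge> 2\<close> R1 True order_refl f, of g w] a(2)
      by (auto simp: Rw)
    have "power_sum_off n d f (m1 + m) (R + (\<Sum>i<m. lf n (b i) ^ d))"
      by (intro power_sum_off_add m1 power_sum_off_sum b)
    then show ?thesis
      using m1(1) by (intro exI[of _ "m1 + m"]) (simp add: R_def)
  next
    case False
    then obtain q y where q: "dderiv q R1 = 0" "y < n - 1" "q y \<noteq> 0"
      by (auto simp: nondegenerate_def)
    obtain R2 v where R2: "R2 \<in> forms (n - 1 - 1) d"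
      and Rv: "R1 = msubst (\<lambda>i. lf (n - 1) (v i)) R2"
      using dderiv_eq_0_imp_fewer_variables[where p = q and z = y, OF R1 q]
      by (elim exE conjE bexE) (rule that)
    \<comment> \<open>The power of \<open>b 0\<close> is decomposed again, together with \<open>R\<close>.\<close>
    have "n - 1 - 1 + 1 \<le> n - 1" using \<open>n \<ge> 2\<close> by simp
    from ork_le_absorb_power[OF ork \<open>d \<ge> 2\<close> R2 this f b[of 0],
        of "\<lambda>i j. \<Sum>k<n-1. v i k * w k j"] \<open>m \<ge> 1\<close>
    obtain m1 where m1: "m1 \<le> M" "power_sum_off n d f m1 (R + lf n (b 0) ^ d)"
      by (auto simp: Rw Rv msubst_lf_compose)
    obtain m2 where m2: "m = Suc m2" using \<open>m \<ge> 1\<close> by (cases m) auto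
    have "power_sum_off n d f (m1 + m2) (R + lf n (b 0) ^ d + (\<Sum>i<m2. lf n (b (Suc i)) ^ d))"
      by (intro power_sum_off_add m1 power_sum_off_sum b) (simp add: m2)
    moreover have "R + lf n (b 0) ^ d + (\<Sum>i<m2. lf n (b (Suc i)) ^ d) = F"
      unfolding R_def m2 sum.lessThan_Suc_shift by simp
    ultimately show ?thesis
      using m1(1) by (intro exI[of _ "m1 + m2"]) (simp add: m2)
  qed
qed

section \<open>Choosing the direction\<close>

lemma ex_dderiv_neq_0:
  fixes F :: "'k::field_char_0 mpoly"
  assumes "F \<in> forms n d" "d \<ge> 1" "F \<noteq> 0"
  shows "\<exists>j. dderiv (axis j) F \<noteq> 0"
proof (rule ccontr)
  assume "\<nexists>j. dderiv (axis j) F \<noteq> 0"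
  then have "F = 0" by (intro forms_eq_0I[OF assms(1,2)]) blast
  with assms(3) show False by contradiction
qed

lemma line_open_second_dderiv:
  "line_open {p. dderiv p (dderiv p F) \<noteq> 0}"
  by (rule line_open_mpoly_neq_0[where \<psi> = "\<lambda>u v. dderiv u (dderiv v F) + dderiv v (dderiv u F)"
        and \<chi> = "\<lambda>u v. dderiv v (dderiv v F)"])
    (simp only: dderiv_add_dir dderiv_add dderiv_smult mconst.hom_mult power2_eq_square
      distrib_left add.assoc mult.assoc)

text \<open>
  Polarisation: if all pure second derivatives vanish, then so do the mixed ones.
\<close>

lemma ex_second_dderiv_neq_0:
  fixes F :: "'k::field_char_0 mpoly"
  assumes F: "F \<in> forms n d" "F \<noteq> 0" and "d \<ge> 2"
  shows "\<exists>p. dderiv p (dderiv p F) \<noteq> 0"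
proof (rule ccontr)
  assume "\<nexists>p. dderiv p (dderiv p F) \<noteq> 0"
  then have *: "dderiv p (dderiv p F) = 0" for p by blast
  obtain i where i: "dderiv (axis i) F \<noteq> 0"
    using ex_dderiv_neq_0[OF F(1) _ F(2)] \<open>d \<ge> 2\<close> by auto
  obtain j where j: "dderiv (axis j) (dderiv (axis i) F) \<noteq> 0"
    using ex_dderiv_neq_0[OF dderiv_forms[OF F(1)] _ i] \<open>d \<ge> 2\<close> by (auto simp: le_diff_conv2)
  let ?D = "\<lambda>p q. dderiv p (dderiv q F)"
  have "dderiv (\<lambda>k. axis i k + axis j k) X = dderiv (axis i) X + dderiv (axis j) X" for X :: "'k mpoly"
    using dderiv_add_dir[of "axis i" 1 "axis j" X] by simp
  then have "?D (\<lambda>k. axis i k + axis j k) (\<lambda>k. axis i k + axis j k) =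
      ?D (axis i) (axis i) + ?D (axis j) (axis i) + (?D (axis i) (axis j) + ?D (axis j) (axis j))"
    by (simp only: dderiv_add ac_simps)
  then have "?D (axis j) (axis i) + ?D (axis j) (axis i) = 0"
    using * dderiv_commute[of "axis i" "axis j" F] by simp
  then have "mconst (1 + 1) * ?D (axis j) (axis i) = 0"
    by (simp only: mconst.hom_add mconst.hom_one distrib_right mult_1_left)
  with j show False by simp
qed

lemma line_open_mixed_dderiv: "line_open {p. dderiv q (dderiv p F) \<noteq> 0}"
  by (rule line_open_mpoly_neq_0[where \<psi> = "\<lambda>u v. dderiv q (dderiv v F)" and \<chi> = "\<lambda>u v. 0"])
    (simp add: dderiv_add_dir dderiv_add dderiv_smult)

lemma ex_mixed_dderiv_neq_0:
  fixes F :: "'k::field_char_0 mpoly"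
  assumes F: "F \<in> forms n d" "d \<ge> 2" and "dderiv q F \<noteq> 0"
  shows "\<exists>p. dderiv q (dderiv p F) \<noteq> 0"
proof -
  obtain j where "dderiv (axis j) (dderiv q F) \<noteq> 0"
    using ex_dderiv_neq_0[OF dderiv_forms[OF F(1)] _ assms(3)] \<open>d \<ge> 2\<close>
    by (auto simp: le_diff_conv2)
  then show ?thesis by (auto simp: dderiv_commute[of "axis j" q])
qed

text \<open>
  A point of the hyperplane orthogonal to \<open>p\<close> that depends linearly on
  \<open>p\<close>. Thus \<open>f\<close> not vanishing there is a generic condition on
  \<open>p\<close> which keeps this hyperplane out of the hypersurface.
\<close>

definition cross_point :: "nat \<Rightarrow> (nat \<Rightarrow> 'k::field) \<Rightarrow> (nat \<Rightarrow> 'k) \<Rightarrow> (nat \<Rightarrow> 'k) \<Rightarrow> nat \<Rightarrow> 'k" where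
  "cross_point n a b p = (\<lambda>j. dot n a p * b j - dot n b p * a j)"

lemma dot_cross_point: "dot n (cross_point n a b p) p = 0"
proof -
  have "cross_point n a b p = (\<lambda>j. dot n a p * b j + (- dot n b p) * a j)"
    by (simp add: cross_point_def)
  then show ?thesis by (simp only: dot_add_left dot_smult_left) simp
qed

lemma line_open_cross_point: "line_open {p. meval (cross_point n a b p) f \<noteq> 0}"
  by (rule line_open_meval_neq_0) (simp add: cross_point_def dot_add_right algebra_simps)

text \<open>
  A direction \<open>p\<close> orthogonal to \<open>b\<close> works: there the point is a
  nonzero multiple of \<open>b\<close>.
\<close>

lemma ex_cross_point_neq_0:
  fixes b :: "nat \<Rightarrow> 'k::field"
  assumes f: "f \<in> forms n e" "meval b f \<noteq> 0" and "n \<ge> 2"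
  shows "\<exists>a p. meval (cross_point n a b p) f \<noteq> 0"
proof -
  obtain p z where p: "dot n b p = 0" "z < n" "p z \<noteq> 0"
  proof (cases "b 0 = 0 \<and> b 1 = 0")
    case True
    show thesis
      by (rule that[of "axis 0" 0]) (use True \<open>n \<ge> 2\<close> in \<open>auto simp: dot_axis axis_same\<close>)
  next
    case False
    \<comment> \<open>The vector \<open>(b\<^sub>1, -b\<^sub>0, 0, \<dots>)\<close>.\<close>
    let ?p = "\<lambda>i. b 1 * axis 0 i + (- b 0) * axis 1 i"
    have "dot n b ?p = 0"
      using \<open>n \<ge> 2\<close> by (simp only: dot_add_right dot_smult_right dot_axis) simp
    moreover have "?p 0 = b 1" "?p 1 = - b 0" by (simp_all add: axis_def)
    ultimately show thesis
      using that[of ?p 0] that[of ?p 1] False \<open>n \<ge> 2\<close> by fastforce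
  qed
  have "cross_point n (axis z) b p = (\<lambda>j. p z * b j)"
    using p by (simp add: cross_point_def dot_axis_left)
  then have "meval (cross_point n (axis z) b p) f \<noteq> 0"
    using f p by (simp add: meval_homogeneous)
  then show ?thesis by blast
qed

section \<open>The recursion\<close>

text \<open>
  The inclusion of the hyperplanes makes \<open>p\<close> a multiple of \<open>q\<close>.
\<close>

lemma dderiv_eq_smult_if_hyperplane_subset:
  assumes F: "F \<in> forms n d" and "z < n" "q z \<noteq> 0"
    and sub: "\<And>y. dot n y q = 0 \<Longrightarrow> dot n p y = 0"
  shows "\<exists>c. dderiv p F = mconst c * dderiv q F"
proof (intro exI)
  have "p i = (p z / q z) * q i" if "i < n" for i
  proof -
    let ?y = "\<lambda>j. axis i j + (- q i / q z) * axis z j"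
    have "dot n ?y q = 0"
      using that assms(2,3) by (simp only: dot_add_left dot_axis_left) simp
    then have "dot n p ?y = 0" by (rule sub)
    then have "p i + (- q i / q z) * p z = 0"
      using that assms(2) by (simp only: dot_add_right dot_axis if_True)
    then show ?thesis by (simp add: mult.commute)
  qed
  then have "dderiv p F = dderiv (\<lambda>i. (p z / q z) * q i) F"
    by (intro dderiv_cong_forms[OF F])
  also have "\<dots> = mconst (p z / q z) * dderiv q F" by (rule dderiv_smult_dir)
  finally show "dderiv p F = mconst (p z / q z) * dderiv q F" .
qed

text \<open>
  The bound for nondegenerate forms extends to a degenerate form, unless the form lives in
  exactly \<open>n - 1\<close> variables which span a hyperplane inside the hypersurface. In
  exactly \<open>n - 1\<close> variables the missing variable is sent to \<open>0\<close>; with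
  fewer variables, two of them are spare.
\<close>

lemma power_sum_off_if_not_degenerate_in_hypersurface:
  fixes G :: "'k::{alg_closed_field,field_char_0} mpoly"
  assumes ork: "ork_le TYPE('k) n d M" and "d \<ge> 2" "n \<ge> 2"
    and G: "G \<in> forms n d" and f: "f \<in> forms n e" "meval b f \<noteq> 0"
    and deg: "\<And>q z. dderiv q G = 0 \<Longrightarrow> z < n \<Longrightarrow> q z \<noteq> 0 \<Longrightarrow>
      \<exists>a. dot n a q = 0 \<and> meval a f \<noteq> 0"
  shows "\<exists>m\<le>M. power_sum_off n d f m G"
proof (cases "nondegenerate n G")
  case True
  then show ?thesis by (rule ork_leD[OF ork G _ f])
next
  case False
  then obtain q z where q: "dderiv q G = 0" "z < n" "q z \<noteq> 0"
    by (auto simp: nondegenerate_def)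
  obtain a where a: "dot n a q = 0" "meval a f \<noteq> 0"
    using deg[of q z, OF q] by (elim exE conjE) (rule that)
  obtain G1 w where G1: "G1 \<in> forms (n - 1) d" and Gw: "G = msubst (\<lambda>i. lf n (w i)) G1"
    and w: "\<forall>a. dot n a q = 0 \<longrightarrow> (\<exists>c. \<forall>j<n. a j = (\<Sum>i<n-1. c i * w i j))"
    using dderiv_eq_0_imp_fewer_variables[where p = q and z = z, OF G q]
    by (elim exE conjE bexE) (rule that)
  show ?thesis
  proof (cases "nondegenerate (n - 1) G1")
    case True
    obtain c where c: "\<forall>j<n. a j = (\<Sum>i<n-1. c i * w i j)"
      using w[rule_format, OF a(1)] by (elim exE) (rule that)
    define v where "v i = (if i < n - 1 then w i else (\<lambda>_. 0))" for i
    obtain k where n: "n = Suc k" using \<open>n \<ge> 2\<close> by (cases n) auto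
    have "meval (\<lambda>j. \<Sum>i<n. c i * v i j) f = meval a f"
      by (rule meval_cong_forms[OF f(1)]) (use c in \<open>simp add: n v_def\<close>)
    with a(2) have "meval (\<lambda>j. \<Sum>i<n. c i * v i j) f \<noteq> 0" by simp
    from ork_le_msubst_add_powers[OF ork \<open>d \<ge> 2\<close> G1 True diff_le_self f(1) this]
    obtain m where m: "m \<le> M"
      "power_sum_off n d f m (msubst (\<lambda>i. lf n (v i)) G1 + (\<Sum>i=n-1..<n. lf n (v i) ^ d))"
      by (elim exE conjE) (rule that)
    have "msubst (\<lambda>i. lf n (v i)) G1 = G"
      unfolding Gw by (rule msubst_cong_forms[OF G1]) (simp add: v_def)
    moreover have "(\<Sum>i=n-1..<n. lf n (v i) ^ d) = 0"
      using \<open>d \<ge> 2\<close> by (simp add: n v_def)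
    ultimately show ?thesis using m by (intro exI[of _ m]) simp
  next
    case False
    then obtain q' z' where q': "dderiv q' G1 = 0" "z' < n - 1" "q' z' \<noteq> 0"
      by (auto simp: nondegenerate_def)
    obtain G2 w' where G2: "G2 \<in> forms (n - 1 - 1) d"
      and Gw': "G1 = msubst (\<lambda>i. lf (n - 1) (w' i)) G2"
      using dderiv_eq_0_imp_fewer_variables[where p = q' and z = z', OF G1 q']
      by (elim exE conjE bexE) (rule that)
    have "n - 1 - 1 + 2 \<le> n" using \<open>n \<ge> 2\<close> by simp
    from ork_le_two_spare_variables[OF ork \<open>d \<ge> 2\<close> G2 this f,
        of "\<lambda>i j. \<Sum>k<n-1. w' i k * w k j"]
    show ?thesis unfolding Gw Gw' msubst_lf_compose .
  qed
qed

text \<open>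
  The direction \<open>p\<close> is chosen generically: \<open>\<partial>\<^sub>p\<^sup>2 F
  \<noteq> 0\<close>, the hyperplane orthogonal to \<open>p\<close> is not contained in the
  hypersurface, and \<open>\<partial>\<^sub>q \<partial>\<^sub>p F \<noteq> 0\<close> for each
  of the finitely many hyperplanes inside the hypersurface, with normal vector \<open>q\<close>.
  The last condition rules out the bad degenerate case for \<open>\<partial>\<^sub>p F\<close>.
  Integration divides by the values of the linear forms at \<open>p\<close>, so the derivative
  is decomposed off the union \<open>g = 0\<close> of the hypersurface with the hyperplane
  orthogonal to \<open>p\<close>.
\<close>

theorem ork_le_recursion:
  assumes "n \<ge> 2" "d \<ge> 3"
    and ork1: "ork_le TYPE('k::{alg_closed_field,field_char_0}) (n - 1) d M"
    and ork2: "ork_le TYPE('k) n (d - 1) M'"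
  shows "ork_le TYPE('k) n d (M + M')"
  unfolding ork_le_def
proof (intro ballI allI impI, elim exE)
  fix F f :: "'k mpoly" and e b
  assume F: "F \<in> forms n d" "nondegenerate n F" and f: "f \<in> forms n e" "meval b f \<noteq> 0"
  have "d \<ge> 2" using \<open>d \<ge> 3\<close> by simp
  let ?Q = "{q. (\<forall>i. i \<notin> {..<n} \<longrightarrow> q i = 0) \<and> dot n b q = 1 \<and>
    (\<forall>a. dot n a q = 0 \<longrightarrow> meval a f = 0)}"
  have dF: "dderiv q F \<noteq> 0" if "i < n" "q i \<noteq> 0" for q i
    using F(2)[unfolded nondegenerate_def, rule_format, of q i] that by blast
  have "F \<noteq> 0"
  proof
    assume "F = 0"
    then show False using dF[of 0 "\<lambda>_. 1"] \<open>n \<ge> 2\<close> by simp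
  qed
  obtain a0 p0 where ap: "meval (cross_point n a0 b p0) f \<noteq> 0"
    using ex_cross_point_neq_0[OF f \<open>n \<ge> 2\<close>] by (elim exE) (rule that)
  let ?U1 = "{p. dderiv p (dderiv p F) \<noteq> 0}" and ?U2 = "{p. meval (cross_point n a0 b p) f \<noteq> 0}"
    and ?U3 = "\<lambda>q. {p. dderiv q (dderiv p F) \<noteq> 0}"
  have "\<Inter>(insert ?U1 (insert ?U2 (?U3 ` ?Q))) \<noteq> {}"
  proof (rule line_open_Inter)
    show "finite (insert ?U1 (insert ?U2 (?U3 ` ?Q)))"
      by (intro finite.insertI finite_imageI finite_hyperplanes_in_hypersurface f(2))
    have "line_open ?U1 \<and> ?U1 \<noteq> {}"
      using line_open_second_dderiv ex_second_dderiv_neq_0[OF F(1) \<open>F \<noteq> 0\<close> \<open>d \<ge> 2\<close>] by blast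
    moreover have "line_open ?U2 \<and> ?U2 \<noteq> {}"
      using line_open_cross_point ap by blast
    moreover have "line_open (?U3 q) \<and> ?U3 q \<noteq> {}" if "q \<in> ?Q" for q
    proof -
      have "\<exists>i<n. q i \<noteq> 0"
      proof (rule ccontr)
        assume "\<nexists>i. i < n \<and> q i \<noteq> 0"
        then have "dot n b q = 0" by (simp add: dot_def)
        with that show False by simp
      qed
      then have "dderiv q F \<noteq> 0" using dF by blast
      then show ?thesis
        using line_open_mixed_dderiv ex_mixed_dderiv_neq_0[OF F(1) \<open>d \<ge> 2\<close>] by blast
    qed
    ultimately show "line_open U \<and> U \<noteq> {}" if "U \<in> insert ?U1 (insert ?U2 (?U3 ` ?Q))" for U
      using that by (elim insertE imageE) (simp_all only: simp_thms)
  qed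
  from ex_in_conv[THEN iffD2, OF this]
  obtain p where p: "p \<in> \<Inter>(insert ?U1 (insert ?U2 (?U3 ` ?Q)))"
    by (elim exE) (rule that)
  have p1: "dderiv p (dderiv p F) \<noteq> 0"
    using InterD[OF p insertI1] by (rule CollectD)
  have p2: "meval (cross_point n a0 b p) f \<noteq> 0"
    using InterD[OF p insertI2[OF insertI1]] by (rule CollectD)
  have p3: "dderiv q (dderiv p F) \<noteq> 0" if "q \<in> ?Q" for q
    using InterD[OF p insertI2[OF insertI2[OF imageI[OF that]]]] by (rule CollectD)
  define G where "G = dderiv p F"
  have G: "G \<in> forms n (d - 1)" unfolding G_def by (rule dderiv_forms[OF F(1)])
  define g where "g = f * lf n p"
  have g: "g \<in> forms n (e + 1)" unfolding g_def by (intro forms_mult f(1) lf_forms)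
  have mg: "meval x g = meval x f * dot n p x" for x
    by (simp add: g_def meval.hom_mult meval_lf)
  have meet: "\<exists>x. dot n x q = 0 \<and> meval x g \<noteq> 0"
    if x: "dot n x q = 0" "meval x f \<noteq> 0" and y: "dot n y q = 0" "dot n p y \<noteq> 0" for q x y
  proof -
    have "meval y (lf n p) \<noteq> 0" using y(2) by (simp only: meval_lf not_False_eq_True)
    from two_forms_nonzero_on_line[OF x(2) this]
    obtain t where t: "meval (\<lambda>i. x i + t * (y i - x i)) f \<noteq> 0"
      "meval (\<lambda>i. x i + t * (y i - x i)) (lf n p) \<noteq> 0"
      by (elim exE conjE) (rule that)
    have "dot n (\<lambda>i. x i + t * (y i + (- 1) * x i)) q = 0"
      by (simp only: dot_add_left x(1) y(1) mult_zero_right add_0_right)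
    then have "dot n (\<lambda>i. x i + t * (y i - x i)) q = 0" by simp
    with t show ?thesis
      by (intro exI[of _ "\<lambda>i. x i + t * (y i - x i)"]) (simp add: mg meval_lf)
  qed
  \<comment> \<open>The two ways in which a hyperplane could lie in \<open>g = 0\<close> are excluded separately: lying in \<open>f = 0\<close> by the
     choice of \<open>p\<close>, and being orthogonal to \<open>p\<close> because \<open>\<partial>\<^sub>p G \<noteq> 0\<close>.\<close>
  have "\<exists>m\<le>M'. power_sum_off n (d - 1) g m G"
  proof -
    have "\<exists>z<n. p z \<noteq> 0"
    proof (rule ccontr)
      assume "\<nexists>z. z < n \<and> p z \<noteq> 0"
      then have "dderiv p F = dderiv (\<lambda>_. 0) F" by (intro dderiv_cong_forms[OF F(1)]) blast
      then have "dderiv p F = 0" by (simp only: dderiv_zero_dir)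
      with p1 show False by simp
    qed
    then obtain z where "z < n" "p z \<noteq> 0" by blast
    then have "dot n p (axis z) \<noteq> 0" by (simp add: dot_axis)
    moreover have "dot n x (\<lambda>_. 0) = 0" for x by (simp add: dot_def)
    ultimately obtain x where x: "meval x g \<noteq> 0"
      using meet[of b "\<lambda>_. 0" "axis z"] f(2) by blast
    have "\<exists>x. dot n x q = 0 \<and> meval x g \<noteq> 0"
      if q: "dderiv q G = 0" "z < n" "q z \<noteq> 0" for q z
    proof -
      have "\<exists>x. dot n x q = 0 \<and> meval x f \<noteq> 0"
      proof (rule ccontr)
        assume *: "\<nexists>x. dot n x q = 0 \<and> meval x f \<noteq> 0"
        then have "dot n b q \<noteq> 0" using f(2) by blast
        define r where "r i = (if i < n then (1 / dot n b q) * q i else 0)" for i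
        have dr: "dot n x r = (1 / dot n b q) * dot n x q" for x
          unfolding dot_smult_right[symmetric] by (rule dot_cong_right) (simp add: r_def)
        have "r \<in> ?Q"
          using * \<open>dot n b q \<noteq> 0\<close> by (auto simp: dr) (simp add: r_def)
        then have "dderiv r G \<noteq> 0" unfolding G_def by (rule p3)
        moreover have "dderiv r G = dderiv (\<lambda>i. (1 / dot n b q) * q i) G"
          by (rule dderiv_cong_forms[OF G]) (simp add: r_def)
        then have "dderiv r G = 0" using q(1) by (simp only: dderiv_smult_dir mult_zero_right)
        ultimately show False by contradiction
      qed
      moreover have "\<exists>y. dot n y q = 0 \<and> dot n p y \<noteq> 0"
      proof (rule ccontr)
        assume "\<nexists>y. dot n y q = 0 \<and> dot n p y \<noteq> 0"
        then have "\<exists>c. dderiv p G = mconst c * dderiv q G"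
          by (intro dderiv_eq_smult_if_hyperplane_subset[of G n "d - 1" z q p] G q) blast
        then have "dderiv p G = 0" using q(1) by auto
        with p1 show False by (simp add: G_def)
      qed
      ultimately show ?thesis using meet by blast
    qed
    then show ?thesis
      using power_sum_off_if_not_degenerate_in_hypersurface[OF ork2 _ \<open>n \<ge> 2\<close> G g x] \<open>d \<ge> 3\<close>
      by (simp add: le_diff_conv2)
  qed
  then obtain m l where m: "m \<le> M'" and l: "\<forall>i<m. meval (l i) g \<noteq> 0"
    and Gl: "G = (\<Sum>i<m. lf n (l i) ^ (d - 1))"
    unfolding power_sum_off_def by (elim exE conjE) (rule that)
  have "m \<noteq> 0"
  proof
    assume "m = 0"
    then have "G = 0" by (simp add: Gl)
    with p1 show False by (simp add: G_def)
  qed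
  have "\<exists>m'\<le>M + m. power_sum_off n d f m' F"
  proof (rule power_sum_off_from_dderiv[OF F(1) \<open>d \<ge> 2\<close> \<open>n \<ge> 2\<close> f(1) dot_cross_point p2
        Gl[unfolded G_def] _ _ _ ork1])
    show "meval (l i) f \<noteq> 0" "dot n (l i) p \<noteq> 0" if "i < m" for i
      using l that by (auto simp: mg dot_commute[of n p])
  qed (use \<open>m \<noteq> 0\<close> in simp)
  then show "\<exists>m\<le>M + M'. power_sum_off n d f m F"
    using m by (meson add_left_mono order_trans)
qed

section \<open>Quadratic forms\<close>

lemma lin_coords_add: "lin_coords (F + G) i = lin_coords F i + lin_coords G i"
  by (simp add: lin_coords_def lookup_add)

lemma lin_coords_smult: "lin_coords (mconst c * F) i = c * lin_coords F i"
  by (simp add: lin_coords_def)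

lemma lin_coords_sum: "lin_coords (\<Sum>x\<in>A. F x) i = (\<Sum>x\<in>A. lin_coords (F x) i)"
  by (simp add: lin_coords_def lookup_sum)

lemma ex_preimage_under_injective_matrix:
  fixes h :: "nat \<Rightarrow> nat \<Rightarrow> 'k::field"
  assumes inj: "\<And>p. (\<And>i. i < n \<Longrightarrow> (\<Sum>j<n. h i j * p j) = 0) \<Longrightarrow> (\<And>j. j < n \<Longrightarrow> p j = 0)"
  shows "\<exists>p. \<forall>i<n. (\<Sum>j<n. h i j * p j) = b i"
proof -
  define A where "A = mat n n (\<lambda>(i, j). h i j)"
  have A: "A \<in> carrier_mat n n" by (simp add: A_def)
  have mv: "(A *\<^sub>v v) $ i = (\<Sum>j<n. h i j * v $ j)" if "i < n" "v \<in> carrier_vec n" for i v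
    using that by (auto simp: A_def scalar_prod_def atLeast0LessThan intro!: sum.cong)
  have "\<not> (\<exists>v. v \<in> carrier_vec n \<and> v \<noteq> 0\<^sub>v n \<and> A *\<^sub>v v = 0\<^sub>v n)"
  proof
    assume "\<exists>v. v \<in> carrier_vec n \<and> v \<noteq> 0\<^sub>v n \<and> A *\<^sub>v v = 0\<^sub>v n"
    then obtain v where v: "v \<in> carrier_vec n" "v \<noteq> 0\<^sub>v n" "A *\<^sub>v v = 0\<^sub>v n"
      by (elim exE conjE) (rule that)
    have "(\<Sum>j<n. h i j * v $ j) = 0" if "i < n" for i
      unfolding mv[OF that v(1), symmetric] v(3) using that by simp
    then have v0: "v $ j = 0" if "j < n" for j using that by (rule inj[where p = "\<lambda>j. v $ j"])
    have "v = 0\<^sub>v n"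
      by (rule eq_vecI) (use v(1) v0 in simp_all)
    with v(2) show False by contradiction
  qed
  then have "det A \<noteq> 0" by (simp only: det_0_iff_vec_prod_zero_field[OF A] not_False_eq_True)
  from det_non_zero_imp_unit[OF A this, of undefined]
  obtain B where B: "B \<in> carrier_mat n n" "A * B = 1\<^sub>m n"
    by (auto simp: Units_def ring_mat_simps)
  define v where "v = B *\<^sub>v vec n b"
  have v: "v \<in> carrier_vec n" using B(1) by (simp add: v_def)
  have "A *\<^sub>v v = (A * B) *\<^sub>v vec n b"
    unfolding v_def by (rule assoc_mult_mat_vec[symmetric, OF A B(1)]) simp
  then have "A *\<^sub>v v = vec n b" by (simp add: B(2))
  then have "(\<Sum>j<n. h i j * v $ j) = b i" if "i < n" for i
    using mv[OF that v] that by simp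
  then show ?thesis by (intro exI[of _ "\<lambda>j. v $ j"]) simp
qed

lemma ex_common_zero:
  fixes a :: "nat \<Rightarrow> nat \<Rightarrow> 'k::field"
  assumes "m < n"
  shows "\<exists>p. (\<forall>i<m. dot n (a i) p = 0) \<and> (\<exists>j<n. p j \<noteq> 0)"
proof (rule ccontr)
  assume *: "\<nexists>p. (\<forall>i<m. dot n (a i) p = 0) \<and> (\<exists>j<n. p j \<noteq> 0)"
  let ?h = "\<lambda>i j. if i < m then a i j else 0"
  have "\<exists>p. \<forall>i<n. (\<Sum>j<n. ?h i j * p j) = axis m i"
  proof (rule ex_preimage_under_injective_matrix)
    fix p j assume p: "\<And>i. i < n \<Longrightarrow> (\<Sum>j<n. ?h i j * p j) = 0" and "j < n"
    have "dot n (a i) p = 0" if "i < m" for i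
      using p[of i] that \<open>m < n\<close> by (simp add: dot_def)
    with * \<open>j < n\<close> show "p j = 0" by blast
  qed
  then obtain p where "\<forall>i<n. (\<Sum>j<n. ?h i j * p j) = axis m i"
    by (elim exE) (rule that)
  from this[rule_format, OF \<open>m < n\<close>] show False by (simp add: axis_same)
qed

lemma ex_dderiv_eq_lf:
  fixes F :: "'k::field_char_0 mpoly"
  assumes F: "F \<in> forms n 2" "nondegenerate n F"
  shows "\<exists>p. dderiv p F = lf n b"
proof -
  have coords: "lin_coords (dderiv p F) i = (\<Sum>j<n. lin_coords (dderiv (axis j) F) i * p j)" for p i
    unfolding dderiv_eq_sum_axis[OF F(1), of p] lin_coords_sum lin_coords_smult
    by (simp add: mult.commute)
  have dF: "lf n (lin_coords (dderiv p F)) = dderiv p F" for p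
    using dderiv_forms[OF F(1), of p] by (intro lf_lin_coords) simp
  have "\<exists>p. \<forall>i<n. (\<Sum>j<n. lin_coords (dderiv (axis j) F) i * p j) = b i"
  proof (rule ex_preimage_under_injective_matrix)
    fix p j assume p: "\<And>i. i < n \<Longrightarrow> (\<Sum>j<n. lin_coords (dderiv (axis j) F) i * p j) = 0" and "j < n"
    have "lf n (lin_coords (dderiv p F)) = lf n (\<lambda>_. 0)"
      by (rule lf_cong) (simp only: coords[of p] p)
    then have "dderiv p F = 0" by (simp add: dF)
    then show "p j = 0" using F(2)[unfolded nondegenerate_def, rule_format, of p j] \<open>j < n\<close> by simp
  qed
  then obtain p where "\<forall>i<n. (\<Sum>j<n. lin_coords (dderiv (axis j) F) i * p j) = b i"
    by (elim exE) (rule that)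
  then have "lf n (lin_coords (dderiv p F)) = lf n b"
    by (intro lf_cong) (simp only: coords[of p])
  then show ?thesis by (intro exI[of _ p]) (simp add: dF)
qed

text \<open>
  The derivative of a quadratic form is a single linear form, and for a nondegenerate one all
  linear forms arise as derivatives. So a generic derivative lies off the hypersurface and
  contributes one power.
\<close>

lemma ork_le_quadratic_step:
  assumes "n \<ge> 2" and ork: "ork_le TYPE('k::{alg_closed_field,field_char_0}) (n - 1) 2 M"
  shows "ork_le TYPE('k) n 2 (M + 1)"
  unfolding ork_le_def
proof (intro ballI allI impI, elim exE)
  fix F f :: "'k mpoly" and e b
  assume F: "F \<in> forms n 2" "nondegenerate n F" and f: "f \<in> forms n e" "meval b f \<noteq> 0"
  have "F \<noteq> 0"
  proof
    assume "F = 0"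
    then show False
      using F(2)[unfolded nondegenerate_def, rule_format, of "\<lambda>_. 1" 0] \<open>n \<ge> 2\<close> by simp
  qed
  obtain a0 p0 where ap: "meval (cross_point n a0 b p0) f \<noteq> 0"
    using ex_cross_point_neq_0[OF f \<open>n \<ge> 2\<close>] by (elim exE) (rule that)
  obtain p1 where p1: "dderiv p1 F = lf n b"
    using ex_dderiv_eq_lf[OF F, of b] by (elim exE) (rule that)
  let ?U1 = "{p. dderiv p (dderiv p F) \<noteq> 0}" and ?U2 = "{p. meval (cross_point n a0 b p) f \<noteq> 0}"
    and ?U3 = "{p. meval (lin_coords (dderiv p F)) f \<noteq> 0}"
  have "\<Inter>{?U1, ?U2, ?U3} \<noteq> {}"
  proof (rule line_open_Inter)
    have U1: "line_open ?U1 \<and> ?U1 \<noteq> {}"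
      using line_open_second_dderiv ex_second_dderiv_neq_0[OF F(1) \<open>F \<noteq> 0\<close> order_refl] by blast
    have U2: "line_open ?U2 \<and> ?U2 \<noteq> {}"
      using line_open_cross_point ap by blast
    have "meval (lin_coords (dderiv p1 F)) f = meval b f"
      unfolding p1 by (rule meval_cong_forms[OF f(1)]) (simp add: lin_coords_lf)
    then have "p1 \<in> ?U3" using f(2) by simp
    moreover have "line_open ?U3"
      by (rule line_open_meval_neq_0) (simp add: dderiv_add_dir lin_coords_add lin_coords_smult)
    ultimately have U3: "line_open ?U3 \<and> ?U3 \<noteq> {}" by blast
    show "line_open U \<and> U \<noteq> {}" if "U \<in> {?U1, ?U2, ?U3}" for U
      using that U1 U2 U3 by (elim insertE emptyE) (simp_all only: simp_thms)
  qed simp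
  from ex_in_conv[THEN iffD2, OF this]
  obtain p where p: "p \<in> \<Inter>{?U1, ?U2, ?U3}"
    by (elim exE) (rule that)
  have p1: "dderiv p (dderiv p F) \<noteq> 0"
    using InterD[OF p insertI1] by (rule CollectD)
  have p2: "meval (cross_point n a0 b p) f \<noteq> 0"
    using InterD[OF p insertI2[OF insertI1]] by (rule CollectD)
  have p3: "meval (lin_coords (dderiv p F)) f \<noteq> 0"
    using InterD[OF p insertI2[OF insertI2[OF insertI1]]] by (rule CollectD)
  let ?l = "lin_coords (dderiv p F)"
  have l: "dderiv p F = lf n ?l"
    using dderiv_forms[OF F(1), of p] by (intro lf_lin_coords[symmetric]) simp
  have "dderiv p (lf n ?l) \<noteq> 0" using p1 by (simp only: l[symmetric] not_False_eq_True)
  then have pl: "dot n ?l p \<noteq> 0" by (simp only: dderiv_lf mconst_eq_0_iff not_False_eq_True)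
  show "\<exists>m\<le>M + 1. power_sum_off n 2 f m F"
  proof (rule power_sum_off_from_dderiv[OF F(1) order_refl \<open>n \<ge> 2\<close> f(1) dot_cross_point p2
        _ order_refl p3 pl ork])
    show "dderiv p F = (\<Sum>i<1::nat. lf n ?l ^ (2 - 1))" using l by simp
  qed
qed

section \<open>One variable\<close>

lemma forms_1_eq:
  assumes "F \<in> forms 1 d"
  shows "\<exists>c. F = mconst c * mvar 0 ^ d"
  using assms
proof (induction rule: forms_induct)
  case (zero d)
  then show ?case by (intro exI[of _ 0]) simp
next
  case (const c)
  then show ?case by (intro exI[of _ c]) simp
next
  case (add d F G)
  then obtain a b where "F = mconst a * mvar 0 ^ d" "G = mconst b * mvar 0 ^ d"
    by (elim exE) (rule that)
  then show ?case by (intro exI[of _ "a + b"]) (simp add: mconst.hom_add distrib_right)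
next
  case (var_mult d i F)
  then obtain a where "F = mconst a * mvar 0 ^ d" by (elim exE) (rule that)
  with var_mult(1) show ?case by (intro exI[of _ a]) simp
qed

lemma ork_le_one_variable:
  assumes "d \<ge> 1"
  shows "ork_le TYPE('k::{alg_closed_field,field_char_0}) 1 d 1"
  unfolding ork_le_def
proof (intro ballI allI impI, elim exE)
  fix F f :: "'k mpoly" and e b
  assume F: "F \<in> forms 1 d" "nondegenerate 1 F" and f: "f \<in> forms 1 e" "meval b f \<noteq> 0"
  obtain \<alpha> where \<alpha>: "F = mconst \<alpha> * mvar 0 ^ d" using forms_1_eq[OF F(1)] by (elim exE) (rule that)
  obtain \<beta> where \<beta>: "f = mconst \<beta> * mvar 0 ^ e" using forms_1_eq[OF f(1)] by (elim exE) (rule that)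
  have "\<alpha> \<noteq> 0"
  proof
    assume "\<alpha> = 0"
    then have "F = 0" by (simp add: \<alpha>)
    then show False using F(2)[unfolded nondegenerate_def, rule_format, of "\<lambda>_. 1" 0] by simp
  qed
  obtain y where y: "y ^ d = \<alpha>" using nth_root_exists[of d \<alpha>] \<open>d \<ge> 1\<close> by auto
  then have "y \<noteq> 0" using \<open>\<alpha> \<noteq> 0\<close> \<open>d \<ge> 1\<close> by (cases "y = 0") (auto simp: power_0_left)
  have "\<beta> \<noteq> 0" using f(2) by (auto simp: \<beta>)
  have "power_sum_off 1 d f 1 (\<Sum>i<1::nat. lf 1 (\<lambda>_. y) ^ d)"
    by (rule power_sum_off_sum[where a = "\<lambda>_ _. y"])
      (simp add: \<beta> meval.hom_mult meval.hom_power \<open>y \<noteq> 0\<close> \<open>\<beta> \<noteq> 0\<close>)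
  moreover have "(\<Sum>i<1::nat. lf 1 (\<lambda>_. y) ^ d) = F"
    by (simp add: lf_def \<alpha> power_mult_distrib y flip: mconst.hom_power)
  ultimately show "\<exists>m\<le>1. power_sum_off 1 d f m F" by (intro exI[of _ 1]) simp
qed

section \<open>Upper bounds\<close>

lemma ork_le_quadratic: "n \<ge> 1 \<Longrightarrow> ork_le TYPE('k::{alg_closed_field,field_char_0}) n 2 n"
proof (induction n rule: dec_induct)
  case base
  show ?case by (rule ork_le_one_variable) simp
next
  case (step n)
  then show ?case using ork_le_quadratic_step[of "Suc n" n] by simp
qed

text \<open>
  The recursion with \<open>n = 2\<close> adds the single power needed in one variable.
\<close>

lemma ork_le_binary: "d \<ge> 2 \<Longrightarrow> ork_le TYPE('k::{alg_closed_field,field_char_0}) 2 d d"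
proof (induction d rule: dec_induct)
  case base
  show ?case by (rule ork_le_quadratic) simp
next
  case (step d)
  have "ork_le TYPE('k) (2 - 1) (Suc d) 1"
    using ork_le_one_variable[of "Suc d"] by simp
  with step show ?case
    using ork_le_recursion[of 2 "Suc d" 1 d] by simp
qed

section \<open>Lower bounds\<close>

text \<open>
  Fewer than \<open>n\<close> linear forms have a common zero \<open>p \<noteq> 0\<close>, and
  the derivative in the direction \<open>p\<close> kills every combination of their squares.
\<close>

lemma ork_le_quadratic_imp_ge:
  assumes "ork_le TYPE('k::field_char_0) n 2 M"
  shows "n \<le> M"
proof (rule ccontr)
  assume "\<not> n \<le> M"
  let ?F = "0 + (\<Sum>i=0..<n. mvar i ^ 2) :: 'k mpoly"
  have nd: "nondegenerate n ?F"
  proof (rule nondegenerate_add_powers)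
    show "nondegenerate 0 (0 :: 'k mpoly)" by (simp add: nondegenerate_def)
  qed auto
  have "mvar i ^ 2 \<in> forms n 2" if "i < n" for i
    using forms_power[OF forms_mvar[OF that], of 2] by simp
  then have F: "?F \<in> forms n 2" by (intro forms_add forms_sum) auto
  have "mconst 1 \<in> forms n 0" "meval (\<lambda>_. 0) (mconst (1::'k)) \<noteq> 0"
    by (rule forms_mconst) simp
  from ork_leD[OF assms F nd this] obtain m where m: "m \<le> M" "power_sum_off n 2 (mconst 1) m ?F"
    by (elim exE conjE) (rule that)
  then obtain a where a: "?F = (\<Sum>i<m. lf n (a i) ^ 2)"
    unfolding power_sum_off_def by (elim exE conjE) (rule that)
  have "m < n" using m(1) \<open>\<not> n \<le> M\<close> by simp
  from ex_common_zero[OF this, of a] obtain p j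
    where p: "\<forall>i<m. dot n (a i) p = 0" "j < n" "p j \<noteq> 0"
    by (elim exE conjE) (rule that)
  have "dderiv p (lf n (a i) ^ 2) = 0" if "i < m" for i
    using p(1) that by (simp add: power2_eq_square dderiv_mult)
  then have "dderiv p ?F = 0" unfolding a dderiv_sum by simp
  with nd p(2,3) show False
    using nd[unfolded nondegenerate_def, rule_format, of p j] by simp
qed

lemma linear_form_as_univariate:
  "aeval (\<lambda>c. [:c:]) (\<lambda>i. if i = 0 then [:0, 1:] else 1) (lf 2 a) = [:a 1, a 0:]"
proof -
  interpret h: comm_ring_hom "aeval (\<lambda>c. [:c:]) (\<lambda>i. if i = 0 then [:0, 1:] else (1 :: 'a poly))"
    by (intro comm_ring_hom_aeval comm_ring_hom_poly_const)
  show ?thesis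
    by (simp add: lf_def numeral_2_eq_2 h.hom_add h.hom_mult comm_ring_hom_poly_const one_pCons)
qed

text \<open>
  A moment argument. Write \<open>t\<^sub>i\<close> for the ratio of the coefficients of the
  \<open>i\<close>-th linear form. Comparing coefficients, the functional \<open>h \<mapsto>
  \<Sum>\<^sub>i (a\<^sub>i\<^sub>1)\<^sup>d h(t\<^sub>i)\<close> on polynomials of degree at
  most \<open>d\<close> is a nonzero multiple of the coefficient of \<open>X\<close>. With fewer
  than \<open>d\<close> points it would vanish on \<open>X \<Prod> (X - t)\<close>, taken over
  the nonzero \<open>t\<^sub>i\<close>, whose coefficient of \<open>X\<close> is not zero.
\<close>

lemma power_sum_monomial_ge:
  fixes a :: "nat \<Rightarrow> nat \<Rightarrow> 'k::field_char_0"
  assumes "d \<ge> 2" and eq: "mvar 0 * mvar 1 ^ (d - 1) = (\<Sum>i<m. lf 2 (a i) ^ d)"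
    and a1: "\<And>i. i < m \<Longrightarrow> a i 1 \<noteq> 0"
  shows "d \<le> m"
proof (rule ccontr)
  assume "\<not> d \<le> m"
  let ?\<Phi> = "aeval (\<lambda>c. [:c:]) (\<lambda>i. if i = 0 then [:0, 1:] else (1 :: 'k poly))"
  interpret h: comm_ring_hom ?\<Phi>
    by (intro comm_ring_hom_aeval comm_ring_hom_poly_const)
  have "[:0, 1:] = ?\<Phi> (mvar 0 * mvar 1 ^ (d - 1))"
    by (simp add: h.hom_mult h.hom_power comm_ring_hom_poly_const)
  also have "\<dots> = (\<Sum>i<m. [:a i 1, a i 0:] ^ d)"
    unfolding eq by (simp only: h.hom_sum h.hom_power linear_form_as_univariate)
  finally have sum: "[:0, 1:] = (\<Sum>i<m. [:a i 1, a i 0:] ^ d)" .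
  have coeff_linear_power': "coeff ([:x, y:] ^ d) j = of_nat (d choose j) * y ^ j * x ^ (d - j)"
    for x y :: 'k and j
  proof (cases "j \<le> d")
    case True
    then show ?thesis by (rule coeff_linear_poly_power)
  next
    case False
    have "degree ([:x, y:] ^ d) \<le> degree [:x, y:] * d" by (rule degree_power_le)
    also have "\<dots> \<le> d" by simp
    finally show ?thesis using False by (simp add: coeff_eq_0 binomial_eq_0)
  qed
  have coeff: "of_nat (d choose j) * (\<Sum>i<m. a i 0 ^ j * a i 1 ^ (d - j)) = (if j = 1 then 1 else 0)"
    for j
  proof -
    have "coeff [:0, 1 :: 'k:] j = (\<Sum>i<m. of_nat (d choose j) * a i 0 ^ j * a i 1 ^ (d - j))"
      unfolding sum coeff_sum coeff_linear_power' ..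
    moreover have "coeff [:0, 1 :: 'k:] j = (if j = 1 then 1 else 0)"
      by (auto simp: coeff_pCons split: nat.splits)
    ultimately show ?thesis by (simp add: sum_distrib_left mult.assoc)
  qed
  \<comment> \<open>The ratio \<open>0\<close> is left out, since \<open>X\<close> already vanishes there and a second factor \<open>X\<close> would kill the coefficient.\<close>
  define T where "T = (\<lambda>i. a i 0 / a i 1) ` {..<m} - {0}"
  have T: "finite T" "card T \<le> m"
    using card_image_le[of "{..<m}" "\<lambda>i. a i 0 / a i 1"]
      card_Diff1_le[of "(\<lambda>i. a i 0 / a i 1) ` {..<m}" 0] by (auto simp: T_def)
  define g where "g = (\<Prod>t\<in>T. [:- t, 1:])"
  have "degree g \<le> (\<Sum>t\<in>T. 1)"
    unfolding g_def by (rule order_trans[OF degree_prod_sum_le[OF T(1)]]) simp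
  then have "degree g \<le> m" using T(2) by simp
  then have deg: "degree ([:0, 1:] * g) \<le> d"
    using \<open>\<not> d \<le> m\<close> degree_mult_le[of "[:0, 1:]" g] by simp
  have root: "poly ([:0, 1:] * g) (a i 0 / a i 1) = 0" if "i < m" for i
  proof (cases "a i 0 = 0")
    case False
    then have "a i 0 / a i 1 \<in> T" using that a1[OF that] by (auto simp: T_def)
    then show ?thesis using T(1) by (auto simp: g_def poly_prod)
  qed simp
  have "0 = (\<Sum>i<m. a i 1 ^ d * poly ([:0, 1:] * g) (a i 0 / a i 1))"
  proof (rule sum.neutral[symmetric], intro ballI)
    fix i assume "i \<in> {..<m}"
    then show "a i 1 ^ d * poly ([:0, 1:] * g) (a i 0 / a i 1) = 0"
      by (simp only: root lessThan_iff mult_zero_right)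
  qed
  also have "\<dots> = (\<Sum>i<m. \<Sum>j\<le>d. coeff ([:0, 1:] * g) j * (a i 0 ^ j * a i 1 ^ (d - j)))"
  proof (rule sum.cong[OF refl])
    fix i assume "i \<in> {..<m}"
    then have i: "a i 1 \<noteq> 0" using a1 by simp
    have "poly ([:0, 1:] * g) (a i 0 / a i 1) =
        (\<Sum>j\<le>d. coeff ([:0, 1:] * g) j * (a i 0 / a i 1) ^ j)"
      unfolding poly_altdef
      by (rule sum.mono_neutral_left) (use deg in \<open>auto simp: coeff_eq_0\<close>)
    moreover have "a i 1 ^ d * (c * (a i 0 / a i 1) ^ j) = c * (a i 0 ^ j * a i 1 ^ (d - j))"
      if "j \<le> d" for c j
      using i that by (simp add: power_divide power_diff)
    ultimately show "a i 1 ^ d * poly ([:0, 1:] * g) (a i 0 / a i 1) =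
        (\<Sum>j\<le>d. coeff ([:0, 1:] * g) j * (a i 0 ^ j * a i 1 ^ (d - j)))"
      by (simp only: sum_distrib_left) (rule sum.cong, auto)
  qed
  also have "\<dots> = (\<Sum>j\<le>d. coeff ([:0, 1:] * g) j * (\<Sum>i<m. a i 0 ^ j * a i 1 ^ (d - j)))"
    by (subst sum.swap) (simp add: sum_distrib_left)
  also have "\<dots> = (\<Sum>j\<le>d. if j = 1 then coeff ([:0, 1:] * g) 1 / of_nat d else 0)"
  proof (rule sum.cong[OF refl])
    fix j assume "j \<in> {..d}"
    then have "of_nat (d choose j) \<noteq> (0 :: 'k)" by simp
    then have "(\<Sum>i<m. a i 0 ^ j * a i 1 ^ (d - j)) = (if j = 1 then 1 else 0) / of_nat (d choose j)"
      by (simp only: coeff[of j, symmetric] nonzero_mult_div_cancel_left not_False_eq_True)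
    then show "coeff ([:0, 1:] * g) j * (\<Sum>i<m. a i 0 ^ j * a i 1 ^ (d - j)) =
        (if j = 1 then coeff ([:0, 1:] * g) 1 / of_nat d else 0)"
      by simp
  qed
  also have "\<dots> = coeff ([:0, 1:] * g) 1 / of_nat d"
    using \<open>d \<ge> 2\<close> by simp
  finally have "coeff ([:0, 1:] * g) 1 = 0" using \<open>d \<ge> 2\<close> by simp
  then have "poly g 0 = 0" by (simp add: poly_0_coeff_0)
  then have "\<exists>t\<in>T. t = 0" using T(1) by (simp add: g_def poly_prod)
  then show False by (simp add: T_def)
qed

text \<open>
  The form \<open>x y\<^bsup>d-1\<^esup>\<close> attains the bound. Avoiding the linear forms
  without \<open>y\<close> makes the ratios of the coefficients finite.
\<close>

lemma ork_le_binary_imp_ge: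
  assumes "d \<ge> 2" "ork_le TYPE('k::field_char_0) 2 d M"
  shows "d \<le> M"
proof -
  obtain k where d: "d = Suc (Suc k)" using \<open>d \<ge> 2\<close> by (metis Suc_le_D numeral_2_eq_2 Suc_le_mono)
  let ?F = "mvar 0 * mvar 1 ^ (d - 1) :: 'k mpoly"
  have "(mvar 1 :: 'k mpoly) ^ (d - 1) \<in> forms 2 (1 * (d - 1))"
    by (rule forms_power[OF forms_mvar]) simp
  from forms_mult[OF forms_mvar[of 0 2] this] have F: "?F \<in> forms 2 d" by (simp add: d)
  have nd: "nondegenerate 2 ?F"
    unfolding nondegenerate_def
  proof (intro allI impI)
    fix p i assume p: "dderiv p ?F = 0" and "i < (2::nat)"
    have dF: "dderiv p ?F = mconst (p 0) * mvar 1 ^ Suc k +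
        mvar 0 * (of_nat (Suc k) * mvar 1 ^ k * mconst (p 1))"
      unfolding d diff_Suc_1 dderiv_mult dderiv_power dderiv_mvar by (rule refl)
    have ev: "p 0 * x 1 ^ Suc k + x 0 * (of_nat (Suc k) * x 1 ^ k * p 1) = 0" for x :: "nat \<Rightarrow> 'k"
    proof -
      have "meval x (dderiv p ?F) = 0" unfolding p by simp
      then show ?thesis
        unfolding dF by (simp only: meval.hom_add meval.hom_mult meval.hom_power meval.hom_of_nat
            meval_mconst meval_mvar)
    qed
    have "p 0 = 0" using ev[of "axis 1"] by (simp add: axis_def)
    moreover from this have "p 1 = 0" using ev[of "\<lambda>_. 1"] by (simp del: of_nat_Suc)
    moreover have "i = 0 \<or> i = 1" using \<open>i < 2\<close> by auto
    ultimately show "p i = 0" by auto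
  qed
  have "(mvar 1 :: 'k mpoly) \<in> forms 2 1" by (rule forms_mvar) simp
  moreover have "meval (\<lambda>_. 1) (mvar 1 :: 'k mpoly) \<noteq> 0" by simp
  ultimately have "\<exists>m\<le>M. power_sum_off 2 d (mvar 1) m ?F"
    by (rule ork_leD[OF assms(2) F nd])
  then obtain m a where m: "m \<le> M" "\<forall>i<m. meval (a i) (mvar 1 :: 'k mpoly) \<noteq> 0"
    "?F = (\<Sum>i<m. lf 2 (a i) ^ d)"
    unfolding power_sum_off_def by (elim exE conjE) (rule that)
  have "d \<le> m"
    by (rule power_sum_monomial_ge[OF \<open>d \<ge> 2\<close> m(3)]) (use m(2) in simp)
  with m(1) show ?thesis by simp
qed

lemma Ork_eqI:
  assumes "ork_le TYPE('k::field_char_0) n d N" "\<And>M. ork_le TYPE('k) n d M \<Longrightarrow> N \<le> M"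
  shows "Ork TYPE('k) n d = enat N"
proof -
  have le: "Ork TYPE('k) n d \<le> enat N" using assms(1) by (simp add: Ork_le_iff)
  then obtain M where M: "Ork TYPE('k) n d = enat M" "M \<le> N"
    by (cases "Ork TYPE('k) n d") auto
  then have "ork_le TYPE('k) n d M" by (simp flip: Ork_le_iff)
  then have "N \<le> M" by (rule assms(2))
  with M show ?thesis by simp
qed

theorem theorem4:
  shows "(\<forall>d\<ge>2. Ork TYPE('k::{alg_closed_field, field_char_0}) 2 d = enat d) \<and>
         (\<forall>n\<ge>2. Ork TYPE('k) n 2 = enat n) \<and>
         (\<forall>n\<ge>3. \<forall>d\<ge>3. Ork TYPE('k) n d \<le> Ork TYPE('k) (n - 1) d + Ork TYPE('k) n (d - 1))"
proof (intro conjI allI impI)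
  fix d :: nat assume d: "d \<ge> 2"
  show "Ork TYPE('k) 2 d = enat d"
    by (rule Ork_eqI[OF ork_le_binary[OF d] ork_le_binary_imp_ge[OF d]])
next
  fix n :: nat assume "n \<ge> 2"
  then have "n \<ge> 1" by simp
  then show "Ork TYPE('k) n 2 = enat n"
    by (rule Ork_eqI[OF ork_le_quadratic ork_le_quadratic_imp_ge])
next
  fix n d :: nat assume nd: "n \<ge> 3" "d \<ge> 3"
  show "Ork TYPE('k) n d \<le> Ork TYPE('k) (n - 1) d + Ork TYPE('k) n (d - 1)"
  proof (cases "Ork TYPE('k) (n - 1) d = \<infinity> \<or> Ork TYPE('k) n (d - 1) = \<infinity>")
    case True
    then show ?thesis by auto
  next
    case False
    then obtain M M' where M: "Ork TYPE('k) (n - 1) d = enat M" "Ork TYPE('k) n (d - 1) = enat M'"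
      by auto
    have "ork_le TYPE('k) (n - 1) d M" "ork_le TYPE('k) n (d - 1) M'"
      unfolding Ork_le_iff[symmetric] M by (rule order_refl)+
    moreover have "n \<ge> 2" using nd(1) by simp
    ultimately have "ork_le TYPE('k) n d (M + M')"
      using nd(2) by (intro ork_le_recursion)
    then show ?thesis unfolding M plus_enat_simps by (simp only: Ork_le_iff)
  qed
qed

end
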